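(* Let $K\neq0$, $\kappa=\sqrt{|K|}$, and let $A,B,C,D$ be four distinct points of an $\Re_K$ domain $(\mathcal M,\rho)$ such that $\rho(A,B)+\rho(B,C)+\rho(C,D)+\rho(D,A)<2\pi/\sqrt K$ if $K>0$. Put $a=\rho(A,B)$, $b=\rho(B,C)$, $c=\rho(C,D)$, $d=\rho(A,D)$, $e=\rho(B,D)$, $f=\rho(A,C)$. If $K>0$ then $$\cos\kappa a+\cos\kappa b+\cos\kappa c+\cos\kappa d\le4\cos\tfrac{\kappa e}{2}\cos\tfrac{\kappa f}{2},$$ and if $K<0$ then $$\cosh\kappa a+\cosh\kappa b+\cosh\kappa c+\cosh\kappa d\ge4\cosh\tfrac{\kappa e}{2}\cosh\tfrac{\kappa f}{2}.$$
   Context: $\Re_K$ domain: a metric space in which any two points are joined by a shortest (curve of length equal to their distance), in which (if $K>0$) every geodesic triangle has perimeter $<2\pi/\sqrt K$, and every geodesic triangle $ABC$ (three distinct points with pairwise joining shortests) has sum of upper angles between its sides at its three vertices at most $\angle_KBAC+\angle_KABC+\angle_KACB$; here $\angle_K$ is the corresponding angle of a triangle with the same side lengths in the model plane $\mathbb S_K$ (open hemisphere of radius $1/\sqrt K$ of the round sphere if $K>0$, hyperbolic plane of curvature $K$ if $K<0$), and the upper angle between shortests $\mathcal L,\mathcal N$ from $O$ is $\limsup\angle_0XOY$ as $X\to O$ in $\mathcal L\setminus\{O\}$, $Y\to O$ in $\mathcal N\setminus\{O\}$ ($\angle_0$ the Euclidean comparison angle). *)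

theory Defs
  imports Complex_Main "HOL-Library.Extended_Real"
begin

definition metric_on :: "'a set \<Rightarrow> ('a \<Rightarrow> 'a \<Rightarrow> real) \<Rightarrow> bool" where
  "metric_on M \<rho> \<longleftrightarrow>
     (\<forall>x\<in>M. \<forall>y\<in>M. 0 \<le> \<rho> x y \<and> (\<rho> x y = 0 \<longleftrightarrow> x = y) \<and> \<rho> x y = \<rho> y x) \<and>
     (\<forall>x\<in>M. \<forall>y\<in>M. \<forall>z\<in>M. \<rho> x z \<le> \<rho> x y + \<rho> y z)"

definition is_curve :: "'a set \<Rightarrow> ('a \<Rightarrow> 'a \<Rightarrow> real) \<Rightarrow> (real \<Rightarrow> 'a) \<Rightarrow> bool" where
  "is_curve M \<rho> \<gamma> \<longleftrightarrow> \<gamma> ` {0..1} \<subseteq> M \<and>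
     (\<forall>t\<in>{0..1}. \<forall>\<epsilon>>0. \<exists>\<delta>>0. \<forall>s\<in>{0..1}. \<bar>s - t\<bar> < \<delta> \<longrightarrow> \<rho> (\<gamma> s) (\<gamma> t) < \<epsilon>)"

definition partitions01 :: "real list set" where
  "partitions01 = {ts. ts \<noteq> [] \<and> sorted_wrt (<) ts \<and> hd ts = 0 \<and> last ts = 1}"

definition curve_length :: "('a \<Rightarrow> 'a \<Rightarrow> real) \<Rightarrow> (real \<Rightarrow> 'a) \<Rightarrow> ereal" where
  "curve_length \<rho> \<gamma> =
     (SUP ts \<in> partitions01. ereal (\<Sum>i<length ts - 1. \<rho> (\<gamma> (ts ! i)) (\<gamma> (ts ! Suc i))))"

definition is_shortest :: "'a set \<Rightarrow> ('a \<Rightarrow> 'a \<Rightarrow> real) \<Rightarrow> 'a \<Rightarrow> 'a \<Rightarrow> 'a set \<Rightarrow> bool" where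
  "is_shortest M \<rho> X Y S \<longleftrightarrow>
     (\<exists>\<gamma>. is_curve M \<rho> \<gamma> \<and> \<gamma> 0 = X \<and> \<gamma> 1 = Y \<and>
          curve_length \<rho> \<gamma> = ereal (\<rho> X Y) \<and> S = \<gamma> ` {0..1})"

definition eucl_angle :: "('a \<Rightarrow> 'a \<Rightarrow> real) \<Rightarrow> 'a \<Rightarrow> 'a \<Rightarrow> 'a \<Rightarrow> real" where
  "eucl_angle \<rho> Q X Y =
     arccos (((\<rho> Q X)\<^sup>2 + (\<rho> Q Y)\<^sup>2 - (\<rho> X Y)\<^sup>2) / (2 * \<rho> Q X * \<rho> Q Y))"

definition upper_angle :: "('a \<Rightarrow> 'a \<Rightarrow> real) \<Rightarrow> 'a \<Rightarrow> 'a set \<Rightarrow> 'a set \<Rightarrow> ereal" where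
  "upper_angle \<rho> Q L N =
     (INF \<epsilon> \<in> {0<..}. SUP p \<in> {(X, Y). X \<in> L - {Q} \<and> Y \<in> N - {Q} \<and> \<rho> Q X < \<epsilon> \<and> \<rho> Q Y < \<epsilon>}.
        ereal (eucl_angle \<rho> Q (fst p) (snd p)))"

text \<open>Angle in the model plane S_K between sides of lengths x and y of a triangle whose
  third side (opposite the angle) has length z.\<close>
definition model_angle :: "real \<Rightarrow> real \<Rightarrow> real \<Rightarrow> real \<Rightarrow> real" where
  "model_angle K x y z =
     (let k = sqrt \<bar>K\<bar> in
      if K > 0 then arccos ((cos (k * z) - cos (k * x) * cos (k * y)) / (sin (k * x) * sin (k * y)))
      else if K < 0 then arccos ((cosh (k * x) * cosh (k * y) - cosh (k * z)) / (sinh (k * x) * sinh (k * y)))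
      else arccos ((x\<^sup>2 + y\<^sup>2 - z\<^sup>2) / (2 * x * y)))"

definition angle_K :: "real \<Rightarrow> ('a \<Rightarrow> 'a \<Rightarrow> real) \<Rightarrow> 'a \<Rightarrow> 'a \<Rightarrow> 'a \<Rightarrow> real" where
  "angle_K K \<rho> B A C = model_angle K (\<rho> A B) (\<rho> A C) (\<rho> B C)"

definition Rk_domain :: "real \<Rightarrow> 'a set \<Rightarrow> ('a \<Rightarrow> 'a \<Rightarrow> real) \<Rightarrow> bool" where
  "Rk_domain K M \<rho> \<longleftrightarrow>
     metric_on M \<rho> \<and>
     (\<forall>X\<in>M. \<forall>Y\<in>M. \<exists>S. is_shortest M \<rho> X Y S) \<and>
     (\<forall>A\<in>M. \<forall>B\<in>M. \<forall>C\<in>M. \<forall>Sab Sbc Sca.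
        A \<noteq> B \<and> B \<noteq> C \<and> A \<noteq> C \<and>
        is_shortest M \<rho> A B Sab \<and> is_shortest M \<rho> B C Sbc \<and> is_shortest M \<rho> C A Sca \<longrightarrow>
          (K > 0 \<longrightarrow> \<rho> A B + \<rho> B C + \<rho> C A < 2 * pi / sqrt K) \<and>
          upper_angle \<rho> A Sab Sca + upper_angle \<rho> B Sab Sbc + upper_angle \<rho> C Sbc Sca
            \<le> ereal (angle_K K \<rho> B A C + angle_K K \<rho> A B C + angle_K K \<rho> A C B))"

end

theory Submission
  imports Defs "HOL-Analysis.Analysis"
begin

text \<open>
  Let \<open>m\<close> be the midpoint of a shortest \<open>AC\<close>. The two upper angles at \<open>m\<close> between \<open>mB\<close> and the two
  halves of \<open>AC\<close> add up to at least \<open>\<pi>\<close>. In an \<open>R\<^sub>K\<close> domain every upper angle is at most the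
  corresponding model angle, so the two model angles at \<open>m\<close> also add up to at least \<open>\<pi>\<close>, and the
  cosine law turns this into \<open>cos \<kappa>a + cos \<kappa>b \<le> 2 cos (\<kappa>f/2) cos (\<kappa>\<cdot>mB)\<close> if \<open>K > 0\<close>, and the
  reversed inequality for \<open>cosh\<close> if \<open>K < 0\<close>. Adding the inequality for \<open>D\<close> and using
  \<open>mB + mD \<ge> e\<close> gives the claim.

  The angle comparison is extracted by a descent argument from the angle sum condition, which only
  controls the sum of the three angles of a triangle.
\<close>

subsection \<open>Shortests as isometric images of intervals\<close>

text \<open>The obstacle is that the angle sum condition bounds no single angle: an excess at one
  vertex can be paid for at the other two. The way out is that an upper angle depends only on germs.
  Fix two sides issuing from \<open>Q\<close> and cut them at distances x and y: the upper angle at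
  \<open>Q\<close> is the same for all these triangles, while the model angle at \<open>Q\<close>
  varies with x and y. An excess at \<open>Q\<close> becomes a deficit of fixed size at one of the
  two moving vertices, and a deficit is what the first variation inequality can exploit, since upper
  angles give upper bounds for distances. Only such bounds are used, so upper angles suffice
  throughout. The logarithm reflects scaling: angles do not change under rescaling, so the effect on
  the model angle at \<open>Q\<close> of moving a vertex by t has to be measured against t / x.
  Measured in ln x, the forced decrease has a lower bound that does not degenerate when the triangle
  shrinks, and a fixed c works everywhere.\<close>

definition geodesic :: "'a set \<Rightarrow> ('a \<Rightarrow> 'a \<Rightarrow> real) \<Rightarrow> real \<Rightarrow> (real \<Rightarrow> 'a) \<Rightarrow> bool" where
  "geodesic M \<rho> L g \<longleftrightarrow> 0 \<le> L \<and> g ` {0..L} \<subseteq> M \<and>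
     (\<forall>s\<in>{0..L}. \<forall>t\<in>{0..L}. \<rho> (g s) (g t) = \<bar>s - t\<bar>)"

lemma metric_onD:
  assumes "metric_on M \<rho>"
  shows "\<And>x y. x \<in> M \<Longrightarrow> y \<in> M \<Longrightarrow> 0 \<le> \<rho> x y"
    and "\<And>x y. x \<in> M \<Longrightarrow> y \<in> M \<Longrightarrow> \<rho> x y = 0 \<longleftrightarrow> x = y"
    and "\<And>x y. x \<in> M \<Longrightarrow> y \<in> M \<Longrightarrow> \<rho> x y = \<rho> y x"
    and "\<And>x y z. x \<in> M \<Longrightarrow> y \<in> M \<Longrightarrow> z \<in> M \<Longrightarrow> \<rho> x z \<le> \<rho> x y + \<rho> y z"
  using assms unfolding metric_on_def by blast+

lemma metric_on_pos:
  assumes "metric_on M \<rho>" "x \<in> M" "y \<in> M" "x \<noteq> y"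
  shows "0 < \<rho> x y"
  using metric_onD(1,2)[OF assms(1), of x y] assms by fastforce

lemma geodesicD:
  assumes "geodesic M \<rho> L g"
  shows "0 \<le> L" "\<And>s. 0 \<le> s \<Longrightarrow> s \<le> L \<Longrightarrow> g s \<in> M"
    and "\<And>s t. 0 \<le> s \<Longrightarrow> s \<le> L \<Longrightarrow> 0 \<le> t \<Longrightarrow> t \<le> L \<Longrightarrow> \<rho> (g s) (g t) = \<bar>s - t\<bar>"
  using assms unfolding geodesic_def by (auto simp: image_subset_iff)

lemma geodesic_restrict:
  assumes "geodesic M \<rho> L g" "0 \<le> l" "l \<le> L"
  shows "geodesic M \<rho> l g"
  using assms unfolding geodesic_def by (auto simp: image_subset_iff)

lemma geodesic_shift:
  assumes "geodesic M \<rho> L g" "0 \<le> l" "l \<le> L"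
  shows "geodesic M \<rho> (L - l) (\<lambda>t. g (l + t))"
  using assms unfolding geodesic_def by (auto simp: image_subset_iff)

lemma geodesic_reverse:
  assumes "geodesic M \<rho> L g"
  shows "geodesic M \<rho> L (\<lambda>t. g (L - t))"
  using assms unfolding geodesic_def by (auto simp: image_subset_iff)

lemma reverse_image: "(\<lambda>t. g (L - t)) ` {0..L} = g ` {0..L::real}"
proof -
  have "(\<lambda>t. g (L - t)) ` {0..L} = g ` ((\<lambda>t. L - t) ` {0..L})" by (simp only: image_image)
  then show ?thesis by simp
qed

text \<open>A curve whose length is the distance of its ends makes every triangle inequality along
  it an equality. Hence \<gamma> is isometric in terms of \<open>q t\<close>, the distance from
  \<open>X\<close>, up to stretches where it stands still. Composing \<gamma> with a right inverse
  of \<open>q\<close> gives the arc length parametrisation.\<close>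

lemma shortest_imp_geodesic:
  assumes met: "metric_on M \<rho>" and S: "is_shortest M \<rho> X Y S"
  obtains g where "geodesic M \<rho> (\<rho> X Y) g" "g 0 = X" "g (\<rho> X Y) = Y" "S = g ` {0..\<rho> X Y}"
proof -
  obtain \<gamma> where cur: "is_curve M \<rho> \<gamma>" and \<gamma>0: "\<gamma> 0 = X" and \<gamma>1: "\<gamma> 1 = Y"
    and len: "curve_length \<rho> \<gamma> = ereal (\<rho> X Y)" and SS: "S = \<gamma> ` {0..1}"
    using S unfolding is_shortest_def by blast
  have inM: "\<gamma> t \<in> M" if "0 \<le> t" "t \<le> 1" for t
    using cur that unfolding is_curve_def by auto
  note m = metric_onD[OF met]
  have part: "(\<Sum>i<length ts - 1. \<rho> (\<gamma> (ts ! i)) (\<gamma> (ts ! Suc i))) \<le> \<rho> X Y"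
    if "ts \<in> partitions01" for ts
  proof -
    have "ereal (\<Sum>i<length ts - 1. \<rho> (\<gamma> (ts ! i)) (\<gamma> (ts ! Suc i))) \<le> curve_length \<rho> \<gamma>"
      unfolding curve_length_def by (rule SUP_upper[OF that])
    then show ?thesis using len by simp
  qed
  have XM: "X \<in> M" "Y \<in> M" using inM[of 0] inM[of 1] \<gamma>0 \<gamma>1 by auto
  have m0: "\<rho> P P = 0" if "P \<in> M" for P using m(2) that by blast
  \<comment> \<open>Lists in \<open>partitions01\<close> increase strictly, so coinciding points
    have to be split off before a partition can be formed.\<close>
  have three: "\<rho> X (\<gamma> t) + \<rho> (\<gamma> t) Y \<le> \<rho> X Y" if "0 \<le> t" "t \<le> 1" for t
  proof (cases "t = 0 \<or> t = 1")
    case True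
    then show ?thesis using \<gamma>0 \<gamma>1 m0[OF XM(1)] m0[OF XM(2)] by auto
  next
    case False
    then have "[0, t, 1] \<in> partitions01" using that unfolding partitions01_def by auto
    from part[OF this] show ?thesis using \<gamma>0 \<gamma>1 by (simp add: lessThan_Suc numeral_2_eq_2)
  qed
  have four: "\<rho> X (\<gamma> s) + \<rho> (\<gamma> s) (\<gamma> t) + \<rho> (\<gamma> t) Y \<le> \<rho> X Y" if "0 \<le> s" "s \<le> t" "t \<le> 1" for s t
  proof (cases "s = 0 \<or> t = 1 \<or> s = t")
    case True
    then consider "\<gamma> s = X" | "\<gamma> t = Y" | "\<gamma> s = \<gamma> t" using \<gamma>0 \<gamma>1 by blast
    then show ?thesis
      using m0[OF XM(1)] m0[OF XM(2)] m0[OF inM[of s]] three[of s] three[of t] that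
      by cases simp_all
  next
    case False
    then have "[0, s, t, 1] \<in> partitions01" using that unfolding partitions01_def by auto
    from part[OF this] show ?thesis using \<gamma>0 \<gamma>1
      by (simp add: lessThan_Suc numeral_2_eq_2 numeral_3_eq_3)
  qed
  define q where "q t = \<rho> X (\<gamma> t)" for t
  have diff: "\<rho> (\<gamma> s) (\<gamma> t) = q t - q s" if "0 \<le> s" "s \<le> t" "t \<le> 1" for s t
    using four[OF that] m(4)[of X "\<gamma> s" "\<gamma> t"] m(4)[of X "\<gamma> t" Y] XM inM[of s] inM[of t] that
    unfolding q_def by linarith
  have dist: "\<rho> (\<gamma> s) (\<gamma> t) = \<bar>q s - q t\<bar>" if "0 \<le> s" "s \<le> 1" "0 \<le> t" "t \<le> 1" for s t
  proof (cases "s \<le> t")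
    case True
    then show ?thesis using diff[of s t] that m(1)[of "\<gamma> s" "\<gamma> t"] inM by auto
  next
    case False
    then show ?thesis using diff[of t s] that m(1)[of "\<gamma> t" "\<gamma> s"] m(3)[of "\<gamma> t" "\<gamma> s"] inM by auto
  qed
  have q0: "q 0 = 0" and q1: "q 1 = \<rho> X Y" using m0[OF XM(1)] \<gamma>0 \<gamma>1 by (auto simp: q_def)
  have qran: "0 \<le> q t \<and> q t \<le> \<rho> X Y" if "0 \<le> t" "t \<le> 1" for t
    using three[OF that] m(1)[of X "\<gamma> t"] m(1)[of "\<gamma> t" Y] XM inM[OF that] by (auto simp: q_def)
  have qcont: "continuous_on {0..1} q"
    unfolding continuous_on_iff
  proof (intro ballI allI impI)
    fix t e :: real assume t: "t \<in> {0..1}" and e: "0 < e"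
    then obtain d where d: "d > 0" "\<forall>s\<in>{0..1}. \<bar>s - t\<bar> < d \<longrightarrow> \<rho> (\<gamma> s) (\<gamma> t) < e"
      using cur unfolding is_curve_def by blast
    show "\<exists>d>0. \<forall>s\<in>{0..1}. dist s t < d \<longrightarrow> dist (q s) (q t) < e"
    proof (intro exI[of _ d] conjI ballI impI)
      fix s assume s: "s \<in> {0..1}" "dist s t < d"
      then have "\<rho> (\<gamma> s) (\<gamma> t) < e" using d(2) by (simp add: dist_real_def)
      then show "dist (q s) (q t) < e" using dist[of s t] s t by (simp add: dist_real_def)
    qed (rule d(1))
  qed
  have ex: "\<exists>s. 0 \<le> s \<and> s \<le> 1 \<and> q s = r" if "0 \<le> r" "r \<le> \<rho> X Y" for r
    using IVT'[of q 0 r 1] q0 q1 qcont that by auto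
  \<comment> \<open>Any choice of preimage will do: where \<open>q\<close> takes the same value
    twice, \<gamma> is at the same point.\<close>
  define \<tau> where "\<tau> r = (SOME s. 0 \<le> s \<and> s \<le> 1 \<and> q s = r)" for r
  have \<tau>: "0 \<le> \<tau> r \<and> \<tau> r \<le> 1 \<and> q (\<tau> r) = r" if "0 \<le> r" "r \<le> \<rho> X Y" for r
    using someI_ex[OF ex[OF that]] unfolding \<tau>_def by blast
  have eq: "\<gamma> (\<tau> (q s)) = \<gamma> s" if "0 \<le> s" "s \<le> 1" for s
    using dist[of "\<tau> (q s)" s] \<tau>[of "q s"] qran[OF that] that
      m(2)[of "\<gamma> (\<tau> (q s))" "\<gamma> s"] inM[of s] inM[of "\<tau> (q s)"] by simp
  define g where "g r = \<gamma> (\<tau> r)" for r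
  have "geodesic M \<rho> (\<rho> X Y) g"
    unfolding geodesic_def
  proof (intro conjI ballI)
    show "0 \<le> \<rho> X Y" by (rule m(1)[OF XM])
    show "g ` {0..\<rho> X Y} \<subseteq> M" using \<tau> inM by (auto simp: g_def)
    fix s t assume "s \<in> {0..\<rho> X Y}" "t \<in> {0..\<rho> X Y}"
    then show "\<rho> (g s) (g t) = \<bar>s - t\<bar>"
      using dist[of "\<tau> s" "\<tau> t"] \<tau>[of s] \<tau>[of t] by (simp add: g_def)
  qed
  moreover have "g 0 = X" "g (\<rho> X Y) = Y"
    using eq[of 0] eq[of 1] q0 q1 \<gamma>0 \<gamma>1 by (auto simp: g_def)
  moreover have "S = g ` {0..\<rho> X Y}"
  proof
    show "g ` {0..\<rho> X Y} \<subseteq> S" using \<tau> SS by (auto simp: g_def)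
    show "S \<subseteq> g ` {0..\<rho> X Y}"
    proof
      fix P assume "P \<in> S"
      then obtain s where s: "0 \<le> s" "s \<le> 1" "P = \<gamma> s" using SS by auto
      then have "P = g (q s)" using eq by (simp add: g_def)
      then show "P \<in> g ` {0..\<rho> X Y}" using qran s by auto
    qed
  qed
  ultimately show thesis by (rule that)
qed

text \<open>On an isometric image all partition sums telescope to the same number \<open>L\<close>,
  so the supremum is taken over a constant family.\<close>

lemma geodesic_imp_shortest:
  assumes "geodesic M \<rho> L g"
  shows "is_shortest M \<rho> (g 0) (g L) (g ` {0..L})"
proof -
  note g = geodesicD[OF assms]
  define \<gamma> where "\<gamma> u = g (u * L)" for u
  have ran: "0 \<le> u * L" "u * L \<le> L" if "0 \<le> u" "u \<le> 1" for u
    using that g(1) by (auto simp: mult_left_le_one_le)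
  have d: "\<rho> (\<gamma> s) (\<gamma> t) = \<bar>s - t\<bar> * L" if "0 \<le> s" "s \<le> 1" "0 \<le> t" "t \<le> 1" for s t
    using g(3)[of "s * L" "t * L"] ran that g(1)
    by (simp add: \<gamma>_def abs_mult flip: left_diff_distrib)
  have "is_curve M \<rho> \<gamma>"
    unfolding is_curve_def
  proof (intro conjI ballI allI impI)
    show "\<gamma> ` {0..1} \<subseteq> M" using g(2) ran by (auto simp: \<gamma>_def)
    fix t \<epsilon> :: real assume t: "t \<in> {0..1}" and e: "0 < \<epsilon>"
    show "\<exists>\<delta>>0. \<forall>s\<in>{0..1}. \<bar>s - t\<bar> < \<delta> \<longrightarrow> \<rho> (\<gamma> s) (\<gamma> t) < \<epsilon>"
    \<comment> \<open>The summand 1 keeps the denominator positive for a geodesic of length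
      0.\<close>
    proof (intro exI[of _ "\<epsilon> / (L + 1)"] conjI ballI impI)
      show "0 < \<epsilon> / (L + 1)" using e g(1) by simp
      fix s assume s: "s \<in> {0..1}" and "\<bar>s - t\<bar> < \<epsilon> / (L + 1)"
      then have "\<bar>s - t\<bar> * (L + 1) < \<epsilon>" using g(1) by (simp add: pos_less_divide_eq)
      moreover have "\<bar>s - t\<bar> * L \<le> \<bar>s - t\<bar> * (L + 1)" by (intro mult_left_mono) auto
      ultimately show "\<rho> (\<gamma> s) (\<gamma> t) < \<epsilon>" using d[of s t] s t by auto
    qed
  qed
  moreover have "curve_length \<rho> \<gamma> = ereal L"
  proof -
    have "(\<Sum>i<length ts - 1. \<rho> (\<gamma> (ts ! i)) (\<gamma> (ts ! Suc i))) = L" if ts: "ts \<in> partitions01" for ts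
    proof -
      have p: "ts \<noteq> []" "sorted_wrt (<) ts" "ts ! 0 = 0" "ts ! (length ts - 1) = 1"
        using ts unfolding partitions01_def by (auto simp: hd_conv_nth last_conv_nth)
      have mono: "ts ! i \<le> ts ! j" if "i \<le> j" "j < length ts" for i j
        using sorted_wrt_nth_less[OF p(2), of i j] that by (cases "i = j") auto
      have in01: "0 \<le> ts ! i" "ts ! i \<le> 1" if "i < length ts" for i
        using mono[of 0 i] mono[of i "length ts - 1"] that p by auto
      have "(\<Sum>i<length ts - 1. \<rho> (\<gamma> (ts ! i)) (\<gamma> (ts ! Suc i)))
          = (\<Sum>i<length ts - 1. ts ! Suc i * L - ts ! i * L)"
      proof (rule sum.cong[OF refl])
        fix i assume "i \<in> {..<length ts - 1}"
        then have i: "i < length ts" "Suc i < length ts" by auto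
        show "\<rho> (\<gamma> (ts ! i)) (\<gamma> (ts ! Suc i)) = ts ! Suc i * L - ts ! i * L"
          using d[of "ts ! i" "ts ! Suc i"] in01[OF i(1)] in01[OF i(2)] mono[of i "Suc i"] i
          by (simp add: left_diff_distrib)
      qed
      also have "\<dots> = L" using p(4) by (subst sum_lessThan_telescope) (simp add: p(3))
      finally show ?thesis .
    qed
    moreover have "partitions01 \<noteq> {}"
    proof -
      have "[0, 1] \<in> partitions01" unfolding partitions01_def by simp
      then show ?thesis by blast
    qed
    ultimately show ?thesis unfolding curve_length_def by simp
  qed
  moreover have "\<rho> (g 0) (g L) = L" using g(1) g(3)[of 0 L] by simp
  moreover have "\<gamma> ` {0..1} = g ` {0..L}"
  proof -
    have "(\<lambda>u. u * L) ` {0..1} = {0..L}"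
      using g(1) by (subst image_mult_atLeastAtMost_if') simp
    moreover have "\<gamma> ` {0..1} = g ` ((\<lambda>u. u * L) ` {0..1})" by (auto simp: \<gamma>_def)
    ultimately show ?thesis by simp
  qed
  ultimately show ?thesis unfolding is_shortest_def
    by (intro exI[of _ \<gamma>]) (simp add: \<gamma>_def)
qed

lemma geodesic_imp_shortest_reverse:
  assumes "geodesic M \<rho> L g"
  shows "is_shortest M \<rho> (g L) (g 0) (g ` {0..L})"
  using geodesic_imp_shortest[OF geodesic_reverse[OF assms]] by (simp add: reverse_image)

subsection \<open>Trigonometry of the model plane\<close>

text \<open>The generalised cosine and sine of curvature \<open>K\<close>. With the factor \<open>sgn K\<close> the cosine laws for
  \<open>K > 0\<close> and \<open>K < 0\<close> take the same form, and \<open>sgn K * cs K\<close> is decreasing in both cases.\<close>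

definition cs :: "real \<Rightarrow> real \<Rightarrow> real" where
  "cs K x = (if K > 0 then cos (sqrt \<bar>K\<bar> * x) else cosh (sqrt \<bar>K\<bar> * x))"

definition sn :: "real \<Rightarrow> real \<Rightarrow> real" where
  "sn K x = (if K > 0 then sin (sqrt \<bar>K\<bar> * x) else sinh (sqrt \<bar>K\<bar> * x))"

definition model_triangle :: "real \<Rightarrow> real \<Rightarrow> real \<Rightarrow> real \<Rightarrow> bool" where
  "model_triangle K x y z \<longleftrightarrow> 0 < x \<and> 0 < y \<and> \<bar>x - y\<bar> \<le> z \<and> z \<le> x + y \<and>
     (K > 0 \<longrightarrow> x + y + z < 2 * pi / sqrt K)"

lemma cs_sn_squared:
  assumes "K \<noteq> 0"
  shows "sgn K * (sn K x)\<^sup>2 = 1 - (cs K x)\<^sup>2"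
  using assms sin_squared_eq[of "sqrt \<bar>K\<bar> * x"] cosh_square_eq[of "sqrt \<bar>K\<bar> * x"]
  by (auto simp: cs_def sn_def sgn_if)

lemma cs_diff:
  assumes "K \<noteq> 0"
  shows "cs K (x - y) = cs K x * cs K y + sgn K * (sn K x * sn K y)"
  using assms by (auto simp: cs_def sn_def sgn_if right_diff_distrib cos_diff cosh_diff)

lemma cs_add:
  assumes "K \<noteq> 0"
  shows "cs K (x + y) = cs K x * cs K y - sgn K * (sn K x * sn K y)"
  using assms by (auto simp: cs_def sn_def sgn_if distrib_left cos_add cosh_add)

lemma sn_pos:
  assumes "K \<noteq> 0" "0 < x" "K > 0 \<Longrightarrow> x < pi / sqrt K"
  shows "0 < sn K x"
  using assms by (auto simp: sn_def pos_less_divide_eq mult.commute intro!: sin_gt_zero)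

lemma sgn_cs_antimono:
  assumes "K \<noteq> 0" "0 \<le> x" "x \<le> y" "K > 0 \<Longrightarrow> y \<le> pi / sqrt K"
  shows "sgn K * cs K y \<le> sgn K * cs K x"
proof (cases "K > 0")
  case True
  then have "sqrt K * y \<le> pi" using assms(4) by (simp add: pos_le_divide_eq mult.commute)
  then show ?thesis using True assms by (auto simp: cs_def intro!: cos_monotone_0_pi_le
      mult_left_mono)
next
  case False
  then show ?thesis using assms by (auto simp: cs_def cosh_real_nonneg_le_iff intro!:
      mult_left_mono)
qed

lemma cs_abs [simp]: "cs K \<bar>x\<bar> = cs K x"
  by (simp add: cs_def abs_if)

lemma sn_has_derivative:
  assumes "(f has_real_derivative f') (at x)"
  shows "((\<lambda>x. sn K (f x)) has_real_derivative sqrt \<bar>K\<bar> * cs K (f x) * f') (at x)"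
  unfolding sn_def cs_def using assms
  by (cases "K > 0") (auto intro!: derivative_eq_intros)

lemma cs_has_derivative:
  assumes "K \<noteq> 0" "(f has_real_derivative f') (at x)"
  shows "((\<lambda>x. cs K (f x)) has_real_derivative - sgn K * sqrt \<bar>K\<bar> * sn K (f x) * f') (at x)"
  unfolding sn_def cs_def using assms
  by (cases "K > 0") (auto intro!: derivative_eq_intros)

text \<open>Bounds \<open>sn K x / x\<close> for both signs of \<open>K\<close>, which removes the
  factor \<open>c / x\<close> produced by differentiating the logarithm. It rests on sin u \<le> u
  and on the mean value theorem for sinh.\<close>

lemma sn_le:
  assumes "0 < x"
  shows "sn K x \<le> sqrt \<bar>K\<bar> * x * cosh (sqrt \<bar>K\<bar> * x)"
proof (cases "K > 0")
  case True
  have "sin (sqrt \<bar>K\<bar> * x) \<le> sqrt \<bar>K\<bar> * x * 1" using assms by (simp add: sin_x_le_x)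
  also have "\<dots> \<le> sqrt \<bar>K\<bar> * x * cosh (sqrt \<bar>K\<bar> * x)"
    using assms by (intro mult_left_mono cosh_real_ge_1) auto
  finally show ?thesis using True by (simp add: sn_def)
next
  case False
  define u where "u = sqrt \<bar>K\<bar> * x"
  have u: "0 \<le> u" using assms by (simp add: u_def)
  have "sinh u \<le> u * cosh u"
  proof (cases "u = 0")
    case False
    with u have "0 < u" by simp
    then have "\<exists>z>0. z < u \<and> sinh u - sinh 0 = (u - 0) * cosh z"
      by (intro MVT2) (auto intro!: derivative_eq_intros)
    then obtain v where v: "0 < v" "v < u" "sinh u = u * cosh v" by auto
    then show ?thesis by (simp add: cosh_real_nonneg_le_iff)
  qed simp
  then show ?thesis using False by (simp add: sn_def u_def)
qed

section \<open>Angles of model triangles: cosine law, projection formula, sine law\<close>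

lemma model_triangle_less_pi:
  assumes "model_triangle K x y z" "K > 0"
  shows "x < pi / sqrt K" "y < pi / sqrt K" "z < pi / sqrt K"
  using assms unfolding model_triangle_def by (auto simp: abs_le_iff)

lemma model_triangle_commute:
  "model_triangle K x y z \<longleftrightarrow> model_triangle K y x z"
  by (auto simp: model_triangle_def abs_minus_commute add_ac)

lemma model_triangle_rotate:
  assumes "model_triangle K x y z" "0 < z"
  shows "model_triangle K x z y"
  using assms by (auto simp: model_triangle_def abs_le_iff add_ac)

lemma model_angle_commute: "model_angle K x y z = model_angle K y x z"
  by (simp add: model_angle_def Let_def ac_simps)

lemma model_angle_eq:
  assumes "K \<noteq> 0"
  shows "model_angle K x y z = arccos (sgn K * (cs K z - cs K x * cs K y) / (sn K x * sn K y))"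
  using assms by (auto simp: model_angle_def Let_def cs_def sn_def)

lemma model_triangle_sn_pos:
  assumes "K \<noteq> 0" "model_triangle K x y z"
  shows "0 < sn K x" "0 < sn K y"
  using assms model_triangle_less_pi[OF assms(2)]
  by (auto intro!: sn_pos simp: model_triangle_def)

text \<open>Monotonicity of \<open>sgn K * cs K\<close> turns |x - y| \<le> z \<le> x + y into
  bounds by the addition formulas. Only with this range is \<open>arccos\<close> in
  \<open>model_angle\<close> a true inverse of the cosine.\<close>

lemma model_cos_bounds:
  assumes K: "K \<noteq> 0" and T: "model_triangle K x y z"
  shows "\<bar>sgn K * (cs K z - cs K x * cs K y) / (sn K x * sn K y)\<bar> \<le> 1"
proof -
  note p = model_triangle_sn_pos[OF K T]
  have sg: "sgn K * sgn K = 1" using K by (auto simp: sgn_if)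
  have up: "sgn K * cs K z \<le> sgn K * cs K (x - y)"
  proof -
    have "sgn K * cs K z \<le> sgn K * cs K \<bar>x - y\<bar>"
      using T model_triangle_less_pi(3)[OF T]
      by (intro sgn_cs_antimono K) (auto simp: model_triangle_def less_imp_le)
    then show ?thesis by simp
  qed
  \<comment> \<open>For \<open>K > 0\<close> the sum x + y may lie beyond
    \<open>pi / sqrt K\<close>, where monotonicity fails. Reflecting it to
    \<open>2 * pi / sqrt K - (x + y)\<close> preserves the cosine, and the perimeter bound places z
    below the reflected value.\<close>
  have lo: "sgn K * cs K (x + y) \<le> sgn K * cs K z"
  proof (cases "K > 0 \<and> x + y > pi / sqrt K")
    case True
    then have Kp: "K > 0" by simp
    have "sgn K * cs K (2 * pi / sqrt K - (x + y)) \<le> sgn K * cs K z"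
      using T True by (intro sgn_cs_antimono K) (auto simp: model_triangle_def abs_le_iff)
    moreover have "cs K (2 * pi / sqrt K - (x + y)) = cs K (x + y)"
      using Kp by (simp add: cs_def right_diff_distrib cos_diff)
    ultimately show ?thesis by simp
  next
    case False
    then show ?thesis using T by (intro sgn_cs_antimono K) (auto simp: model_triangle_def)
  qed
  have a: "sgn K * cs K (x - y) = sgn K * (cs K x * cs K y) + sn K x * sn K y"
    unfolding cs_diff[OF K] distrib_left mult.assoc[symmetric] sg by simp
  have b: "sgn K * cs K (x + y) = sgn K * (cs K x * cs K y) - sn K x * sn K y"
    unfolding cs_add[OF K] right_diff_distrib mult.assoc[symmetric] sg by simp
  have "\<bar>sgn K * (cs K z - cs K x * cs K y)\<bar> \<le> sn K x * sn K y"
    using up lo a b by (auto simp: abs_le_iff right_diff_distrib)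
  moreover have "0 < sn K x * sn K y" using p by simp
  ultimately show ?thesis by (simp add: abs_divide abs_of_pos)
qed

lemma model_angle_bounds:
  assumes "K \<noteq> 0" "model_triangle K x y z"
  shows "0 \<le> model_angle K x y z" "model_angle K x y z \<le> pi"
  using model_cos_bounds[OF assms] unfolding model_angle_eq[OF assms(1)] abs_le_iff
  by (simp_all add: arccos_lbound arccos_ubound)

lemma cos_model_angle:
  assumes K: "K \<noteq> 0" and T: "model_triangle K x y z"
  shows "sn K x * sn K y * cos (model_angle K x y z) = sgn K * (cs K z - cs K x * cs K y)"
  using model_cos_bounds[OF assms] model_triangle_sn_pos[OF assms]
  unfolding model_angle_eq[OF assms(1)] by (simp add: cos_arccos_abs)

lemma model_angle_eq_0:
  assumes K: "K \<noteq> 0" and T: "model_triangle K x y \<bar>x - y\<bar>"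
  shows "model_angle K x y \<bar>x - y\<bar> = 0"
proof -
  have sg: "sgn K * sgn K = 1" using K by (auto simp: sgn_if)
  have "sgn K * (cs K \<bar>x - y\<bar> - cs K x * cs K y) = (sgn K * sgn K) * (sn K x * sn K y)"
    by (simp add: cs_diff[OF K] mult.assoc)
  then show ?thesis using model_triangle_sn_pos[OF K T] using K by (simp add: model_angle_eq[OF K])
qed

text \<open>This is the five-element formula, obtained by using the cosine law at two vertices.
  Divided by \<open>sn K z\<close>, its left side is the derivative of z with respect to x at fixed
  y and fixed angle, so it is the first variation formula of the model plane.\<close>

lemma model_projection:
  assumes K: "K \<noteq> 0" and T: "model_triangle K x y z" and z: "0 < z"
  shows "sn K x * cs K y - cs K x * (sn K y * cos (model_angle K x y z))
         = sn K z * cos (model_angle K x z y)"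
proof -
  have sg: "sgn K * sgn K = 1" using K by (auto simp: sgn_if)
  have T': "model_triangle K x z y" by (rule model_triangle_rotate[OF T z])
  have sx: "sn K x \<noteq> 0" using model_triangle_sn_pos[OF K T] by simp
  have sq: "sn K x * sn K x = sgn K * (1 - cs K x * cs K x)"
    using cs_sn_squared[OF K, of x] sg by (metis mult.assoc mult_1 power2_eq_square)
  have "sn K x * (sn K x * cs K y - cs K x * (sn K y * cos (model_angle K x y z)))
    = sn K x * sn K x * cs K y - cs K x * (sn K x * sn K y * cos (model_angle K x y z))"
    by (simp add: algebra_simps)
  also have "\<dots> = sgn K * (cs K y - cs K x * cs K z)"
    unfolding sq cos_model_angle[OF K T] by (simp add: algebra_simps)
  also have "\<dots> = sn K x * (sn K z * cos (model_angle K x z y))"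
    using cos_model_angle[OF K T'] by (simp add: mult.assoc)
  finally show ?thesis using sx by simp
qed

text \<open>After multiplication by \<open>sn K x\<close> both sides have the same square: the
  determinant of the symmetric matrix with unit diagonal and the three values of \<open>cs K\<close>
  off the diagonal, which does not distinguish y from z.\<close>

lemma model_sine_law:
  assumes K: "K \<noteq> 0" and T: "model_triangle K x y z" and z: "0 < z"
  shows "sn K y * sin (model_angle K x y z) = sn K z * sin (model_angle K x z y)"
proof -
  have T': "model_triangle K x z y" by (rule model_triangle_rotate[OF T z])
  note p = model_triangle_sn_pos[OF K T] model_triangle_sn_pos[OF K T']
  have sg: "sgn K * sgn K = 1" using K by (auto simp: sgn_if)
  have sq: "(sn K v)\<^sup>2 = sgn K * (1 - (cs K v)\<^sup>2)" for v
    using cs_sn_squared[OF K, of v] sg by (metis mult.assoc mult_1)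
  have key: "(sn K x * (sn K y * sin (model_angle K x y z)))\<^sup>2
      = 1 - (cs K x)\<^sup>2 - (cs K y)\<^sup>2 - (cs K z)\<^sup>2 + 2 * cs K x * cs K y * cs K z"
    if T: "model_triangle K x y z" for y z
  proof -
    have "(sn K x * (sn K y * sin (model_angle K x y z)))\<^sup>2
      = (sn K x)\<^sup>2 * (sn K y)\<^sup>2 - (sn K x * sn K y * cos (model_angle K x y z))\<^sup>2"
      by (simp add: power_mult_distrib sin_squared_eq algebra_simps)
    also have "\<dots> = (sgn K * sgn K) * ((1 - (cs K x)\<^sup>2) * (1 - (cs K y)\<^sup>2) - (cs K z
        - cs K x * cs K y)\<^sup>2)"
      unfolding sq cos_model_angle[OF K T] by (simp add: power2_eq_square algebra_simps)
    finally show ?thesis unfolding sg by (simp add: power2_eq_square algebra_simps)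
  qed
  have "(sn K x * (sn K y * sin (model_angle K x y z)))\<^sup>2
      = (sn K x * (sn K z * sin (model_angle K x z y)))\<^sup>2"
    unfolding key[OF T] key[OF T'] by (simp add: algebra_simps)
  then have "sn K x * (sn K y * sin (model_angle K x y z))
      = sn K x * (sn K z * sin (model_angle K x z y))"
  proof (rule power2_eq_imp_eq)
    show "0 \<le> sn K x * (sn K y * sin (model_angle K x y z))"
      using p model_angle_bounds[OF K T] by (intro mult_nonneg_nonneg sin_ge_zero) auto
    show "0 \<le> sn K x * (sn K z * sin (model_angle K x z y))"
      using p model_angle_bounds[OF K T'] by (intro mult_nonneg_nonneg sin_ge_zero) auto
  qed
  then show ?thesis using p by simp
qed

text \<open>An excess \<eta> at the first vertex forces a deficit of at least \<eta> / 2 at one of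
  the others. Within [0, pi], lowering an angle by \<eta> / 2 raises its cosine least at the ends of
  the interval, namely by 1 - cos (\<eta> / 2) = 2 sin (\<eta> / 4) squared. An error
  \<open>e\<close> below this cannot hide the deficit.\<close>

lemma angle_sum_contradiction:
  fixes \<alpha> f \<beta> \<beta>' \<gamma> \<gamma>' :: real
  assumes sum: "\<alpha> + \<beta> + \<gamma> \<le> f + \<beta>' + \<gamma>'"
    and \<eta>: "0 < \<eta>" "\<eta> \<le> \<alpha> - f"
    and e: "e < 2 * (sin (\<eta> / 4))\<^sup>2"
    and ran: "0 \<le> \<beta>" "\<beta>' \<le> pi" "0 \<le> \<gamma>" "\<gamma>' \<le> pi"
    and le: "cos \<beta> \<le> cos \<beta>' + e" "cos \<gamma> \<le> cos \<gamma>' + e"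
  shows False
proof -
  have key: "cos b' + 2 * (sin (\<eta> / 4))\<^sup>2 \<le> cos b"
    if "0 \<le> b" "b' \<le> pi" "b \<le> b' - \<eta> / 2" for b b' :: real
  proof -
    have "cos (b' - \<eta> / 2) \<le> cos b" using that \<eta> by (intro cos_monotone_0_pi_le) auto
    moreover have "cos (b' - \<eta> / 2) - cos b' = 2 * (sin (b' - \<eta> / 4) * sin (\<eta> / 4))"
      by (subst cos_diff_cos) (simp add: field_simps)
    moreover have "sin (\<eta> / 4) * sin (\<eta> / 4) \<le> sin (b' - \<eta> / 4) * sin (\<eta> / 4)"
    proof (rule mult_right_mono)
      have lt: "\<eta> / 4 \<le> b' - \<eta> / 4" "b' - \<eta> / 4 \<le> pi - \<eta> / 4" using that \<eta> by auto
      show "sin (\<eta> / 4) \<le> sin (b' - \<eta> / 4)"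
      proof (cases "b' - \<eta> / 4 \<le> pi / 2")
        case True
        then show ?thesis using lt \<eta> by (intro sin_monotone_2pi_le) auto
      next
        case False
        then have "sin (\<eta> / 4) \<le> sin (pi - (b' - \<eta> / 4))"
          using lt \<eta> that by (intro sin_monotone_2pi_le) auto
        then show ?thesis by (simp only: sin_pi_minus)
      qed
      show "0 \<le> sin (\<eta> / 4)" using lt \<eta> that by (intro sin_ge_zero) auto
    qed
    ultimately show ?thesis by (simp add: power2_eq_square)
  qed
  have "\<beta> \<le> \<beta>' - \<eta> / 2 \<or> \<gamma> \<le> \<gamma>' - \<eta> / 2" using sum \<eta> by linarith
  then show False using key[of \<beta> \<beta>'] key[of \<gamma> \<gamma>'] ran le e by auto
qed

subsection \<open>Upper angles and first variation\<close>

lemma cos_eucl_angle: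
  assumes met: "metric_on M \<rho>" and M: "Q \<in> M" "X \<in> M" "Y \<in> M" and ne: "X \<noteq> Q" "Y \<noteq> Q"
  shows "0 \<le> eucl_angle \<rho> Q X Y" "eucl_angle \<rho> Q X Y \<le> pi"
    and "(\<rho> X Y)\<^sup>2 = (\<rho> Q X)\<^sup>2 + (\<rho> Q Y)\<^sup>2 - 2 * \<rho> Q X * \<rho> Q Y * cos (eucl_angle \<rho> Q X Y)"
proof -
  note m = metric_onD[OF met]
  define a b c where "a = \<rho> Q X" and "b = \<rho> Q Y" and "c = \<rho> X Y"
  have p: "0 < a" "0 < b" "0 \<le> c"
    using metric_on_pos[OF met] m(1) M ne by (auto simp: a_def b_def c_def)
  have t: "c \<le> a + b" "a \<le> b + c" "b \<le> a + c"
    using m(4)[of X Q Y] m(4)[of Q Y X] m(4)[of Q X Y] m(3)[of Q X] m(3)[of X Y] M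
    by (auto simp: a_def b_def c_def)
  have "c\<^sup>2 \<le> (a + b)\<^sup>2" using t p by (intro power_mono) auto
  moreover have "(a - b)\<^sup>2 \<le> c\<^sup>2" using t p by (intro abs_le_square_iff[THEN iffD1]) auto
  ultimately have "\<bar>a\<^sup>2 + b\<^sup>2 - c\<^sup>2\<bar> \<le> 2 * a * b"
    by (auto simp: abs_le_iff power2_eq_square algebra_simps)
  then have r: "\<bar>(a\<^sup>2 + b\<^sup>2 - c\<^sup>2) / (2 * a * b)\<bar> \<le> 1"
    using p by (simp add: abs_divide abs_mult)
  have e: "eucl_angle \<rho> Q X Y = arccos ((a\<^sup>2 + b\<^sup>2 - c\<^sup>2) / (2 * a * b))"
    by (simp add: eucl_angle_def a_def b_def c_def)
  show "0 \<le> eucl_angle \<rho> Q X Y" "eucl_angle \<rho> Q X Y \<le> pi"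
    using r unfolding e abs_le_iff by (simp_all add: arccos_lbound arccos_ubound)
  have "2 * a * b * cos (eucl_angle \<rho> Q X Y) = a\<^sup>2 + b\<^sup>2 - c\<^sup>2"
    unfolding e cos_arccos_abs[OF r] using p by simp
  then show "(\<rho> X Y)\<^sup>2 = (\<rho> Q X)\<^sup>2 + (\<rho> Q Y)\<^sup>2 - 2 * \<rho> Q X * \<rho> Q Y * cos (eucl_angle \<rho> Q X Y)"
    by (simp add: a_def b_def c_def)
qed

lemma upper_angle_commute:
  assumes met: "metric_on M \<rho>" and "L \<subseteq> M" "N \<subseteq> M"
  shows "upper_angle \<rho> Q L N = upper_angle \<rho> Q N L"
proof -
  have le: "upper_angle \<rho> Q L N \<le> upper_angle \<rho> Q N L" if LN: "L \<subseteq> M" "N \<subseteq> M" for L N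
    unfolding upper_angle_def
  proof (intro INF_mono bexI[rotated] SUP_mono)
    fix \<epsilon> :: real and p
    assume p: "p \<in> {(X, Y). X \<in> L - {Q} \<and> Y \<in> N - {Q} \<and> \<rho> Q X < \<epsilon> \<and> \<rho> Q Y < \<epsilon>}"
    show "(snd p, fst p) \<in> {(X, Y). X \<in> N - {Q} \<and> Y \<in> L - {Q} \<and> \<rho> Q X < \<epsilon> \<and> \<rho> Q Y < \<epsilon>}"
      using p by auto
    have "\<rho> (fst p) (snd p) = \<rho> (snd p) (fst p)" 
      by (rule metric_onD(3)[OF met]) (use p LN in auto)
    then show "ereal (eucl_angle \<rho> Q (fst p) (snd p))
        \<le> ereal (eucl_angle \<rho> Q (fst (snd p, fst p)) (snd (snd p, fst p)))"
      by (simp add: eucl_angle_def ac_simps)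
  qed auto
  show ?thesis using le[of L N] le[of N L] assms by (simp add: antisym)
qed

text \<open>The infimum over \<epsilon> may be restricted to \<epsilon> \<le> \<delta>. This is the
  locality that keeps the angle at \<open>Q\<close> unchanged when the sides are shortened.\<close>

lemma upper_angle_local_mono:
  assumes "0 < \<delta>" and L: "\<And>X. X \<in> L \<Longrightarrow> \<rho> Q X < \<delta> \<Longrightarrow> X \<in> L'"
    and N: "\<And>Y. Y \<in> N \<Longrightarrow> \<rho> Q Y < \<delta> \<Longrightarrow> Y \<in> N'"
  shows "upper_angle \<rho> Q L N \<le> upper_angle \<rho> Q L' N'"
  unfolding upper_angle_def
proof (intro INF_mono)
  fix \<epsilon> :: real assume e: "\<epsilon> \<in> {0<..}"
  show "\<exists>e\<in>{0<..}. (SUP p\<in>{(X, Y). X \<in> L - {Q} \<and> Y \<in> N - {Q} \<and> \<rho> Q X < e \<and> \<rho> Q Y < e}.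
        ereal (eucl_angle \<rho> Q (fst p) (snd p)))
      \<le> (SUP p\<in>{(X, Y). X \<in> L' - {Q} \<and> Y \<in> N' - {Q} \<and> \<rho> Q X < \<epsilon> \<and> \<rho> Q Y < \<epsilon>}.
        ereal (eucl_angle \<rho> Q (fst p) (snd p)))"
    using e assms by (intro bexI[of _ "min \<epsilon> \<delta>"] SUP_subset_mono) auto
qed

text \<open>Positive lengths matter: without points near \<open>Q\<close> the supremum in
  \<open>ereal\<close> would be over the empty set, that is, minus infinity. Given such points, the
  bounds for \<open>eucl_angle\<close> pass to the limit and cosines may be taken.\<close>

lemma upper_angle_real:
  assumes met: "metric_on M \<rho>" and g: "geodesic M \<rho> x g" and h: "geodesic M \<rho> y h"
    and Q: "g 0 = Q" "h 0 = Q" and pos: "0 < x" "0 < y"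
  obtains \<alpha> where "upper_angle \<rho> Q (g ` {0..x}) (h ` {0..y}) = ereal \<alpha>" "0 \<le> \<alpha>" "\<alpha> \<le> pi"
proof -
  let ?P = "\<lambda>\<epsilon>::real. {(X, Y). X \<in> g ` {0..x} - {Q} \<and> Y \<in> h ` {0..y} - {Q} \<and> \<rho> Q X < \<epsilon> \<and> \<rho> Q Y < \<epsilon>}"
  let ?S = "\<lambda>\<epsilon>::real. SUP p \<in> ?P \<epsilon>. ereal (eucl_angle \<rho> Q (fst p) (snd p))"
  note gd = geodesicD[OF g] and hd = geodesicD[OF h]
  have QM: "Q \<in> M" using gd(2)[of 0] Q pos by simp
  have b: "0 \<le> eucl_angle \<rho> Q (fst p) (snd p)" "eucl_angle \<rho> Q (fst p) (snd p) \<le> pi"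
    if "p \<in> ?P \<epsilon>" for p \<epsilon>
  proof -
    have "fst p \<in> M" "snd p \<in> M" "fst p \<noteq> Q" "snd p \<noteq> Q" using that gd(2) hd(2) by auto
    then show "0 \<le> eucl_angle \<rho> Q (fst p) (snd p)" "eucl_angle \<rho> Q (fst p) (snd p) \<le> pi"
      by (rule cos_eucl_angle(1,2)[OF met QM])+
  qed
  have up: "?S \<epsilon> \<le> ereal pi" for \<epsilon>
    using b(2)[of _ \<epsilon>] by (intro SUP_least) simp
  have lo: "0 \<le> ?S \<epsilon>" if "0 < \<epsilon>" for \<epsilon>
  proof -
    define r where "r = min (\<epsilon> / 2) (min x y)"
    have r: "0 < r" "r < \<epsilon>" "r \<le> x" "r \<le> y" using that pos by (auto simp: r_def)
    have "\<rho> Q (g r) = r" "\<rho> Q (h r) = r" "\<rho> Q Q = 0"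
      using gd(3)[of 0 r] hd(3)[of 0 r] gd(3)[of 0 0] Q r by auto
    then have p: "(g r, h r) \<in> ?P \<epsilon>" using r by auto
    have "0 \<le> ereal (eucl_angle \<rho> Q (fst (g r, h r)) (snd (g r, h r)))" using b(1)[OF p] by simp
    also have "\<dots> \<le> ?S \<epsilon>" by (rule SUP_upper[OF p])
    finally show ?thesis .
  qed
  have U: "upper_angle \<rho> Q (g ` {0..x}) (h ` {0..y}) = (INF \<epsilon>\<in>{0<..}. ?S \<epsilon>)"
    by (simp only: upper_angle_def)
  have "(INF \<epsilon>\<in>{0<..}. ?S \<epsilon>) \<le> ?S 1" by (intro INF_lower) simp
  then have 1: "upper_angle \<rho> Q (g ` {0..x}) (h ` {0..y}) \<le> ereal pi"
    unfolding U using up[of 1] by (rule order_trans)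
  have 2: "0 \<le> upper_angle \<rho> Q (g ` {0..x}) (h ` {0..y})"
    unfolding U using lo by (intro INF_greatest) auto
  obtain \<alpha> where \<alpha>: "upper_angle \<rho> Q (g ` {0..x}) (h ` {0..y}) = ereal \<alpha>"
    using 1 2 by (cases "upper_angle \<rho> Q (g ` {0..x}) (h ` {0..y})") auto
  show thesis using that[OF \<alpha>] 1 2 unfolding \<alpha> by simp
qed

text \<open>The Euclidean law of cosines is applied to a short triangle \<open>Q\<close>,
  \<open>g t\<close>, \<open>h s\<close>, and the triangle inequality covers the rest of
  \<open>h\<close>. The point \<open>h s\<close> is fixed before t tends to 0, so the second order
  term t^2 / (2 s) is eventually at most t e / 2.\<close>

lemma first_variation:
  assumes met: "metric_on M \<rho>" and g: "geodesic M \<rho> x g" and h: "geodesic M \<rho> y h"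
    and Q: "g 0 = Q" "h 0 = Q" and pos: "0 < x" "0 < y"
    and ang: "upper_angle \<rho> Q (g ` {0..x}) (h ` {0..y}) = ereal \<alpha>" "0 \<le> \<alpha>" "\<alpha> \<le> pi"
    and e: "0 < e"
  shows "\<forall>\<^sub>F t in at_right 0. \<rho> (g t) (h y) \<le> y - t * (cos \<alpha> - e)"
proof -
  let ?P = "\<lambda>\<epsilon>::real. {(X, Y). X \<in> g ` {0..x} - {Q} \<and> Y \<in> h ` {0..y} - {Q} \<and> \<rho> Q X < \<epsilon> \<and> \<rho> Q Y < \<epsilon>}"
  let ?S = "\<lambda>\<epsilon>::real. SUP p \<in> ?P \<epsilon>. ereal (eucl_angle \<rho> Q (fst p) (snd p))"
  note gd = geodesicD[OF g] and hd = geodesicD[OF h] and m = metric_onD[OF met]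
  have QM: "Q \<in> M" using gd(2)[of 0] Q pos by simp
  have "(INF \<epsilon>\<in>{0<..}. ?S \<epsilon>) < ereal (\<alpha> + e / 2)"
    using ang e unfolding upper_angle_def by simp
  then obtain d where d: "0 < d" "?S d < ereal (\<alpha> + e / 2)"
    unfolding INF_less_iff by auto
  define s where "s = min (d / 2) y"
  have s: "0 < s" "s < d" "s \<le> y" using d pos by (auto simp: s_def)
  have key: "\<rho> (g t) (h y) \<le> y - t * (cos \<alpha> - e)" if t: "0 < t" "t < d" "t \<le> x" "t \<le> e * s" for t
  proof -
    define \<theta> where "\<theta> = eucl_angle \<rho> Q (g t) (h s)"
    have MM: "g t \<in> M" "h s \<in> M" "h y \<in> M" using gd(2) hd(2) t s pos by auto
    have r: "\<rho> Q (g t) = t" "\<rho> Q (h s) = s" "\<rho> Q Q = 0" "\<rho> (h s) (h y) = y - s"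
      using gd(3)[of 0 t] hd(3)[of 0 s] gd(3)[of 0 0] hd(3)[of s y] Q t s pos by auto
    have p: "(g t, h s) \<in> ?P d" using r t s by auto
    have ne: "g t \<noteq> Q" "h s \<noteq> Q" using p by auto
    have "ereal \<theta> \<le> ?S d"
      using SUP_upper[OF p, of "\<lambda>p. ereal (eucl_angle \<rho> Q (fst p) (snd p))"] by (simp add: \<theta>_def)
    then have "ereal \<theta> < ereal (\<alpha> + e / 2)" using d(2) by (rule order_le_less_trans)
    then have th: "\<theta> \<le> \<alpha> + e / 2" by simp
    note ce = cos_eucl_angle[OF met QM MM(1,2) ne, folded \<theta>_def, unfolded r]
    have cth: "cos \<alpha> - e / 2 \<le> cos \<theta>"
    proof (cases "\<theta> \<le> \<alpha>")
      case True
      then have "cos \<alpha> \<le> cos \<theta>" using ce ang by (intro cos_monotone_0_pi_le) auto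
      then show ?thesis using e by simp
    next
      case False
      have "\<bar>cos \<alpha> - cos \<theta>\<bar> = 2 * (\<bar>sin ((\<alpha> + \<theta>) / 2)\<bar> * \<bar>sin ((\<theta> - \<alpha>) / 2)\<bar>)"
        by (simp add: cos_diff_cos abs_mult)
      also have "\<dots> \<le> 2 * (1 * \<bar>(\<theta> - \<alpha>) / 2\<bar>)"
        by (intro mult_left_mono mult_mono abs_sin_le_one abs_sin_x_le_abs_x) auto
      finally have "\<bar>cos \<alpha> - cos \<theta>\<bar> \<le> \<bar>\<alpha> - \<theta>\<bar>" by simp
      then show ?thesis using False th by linarith
    qed
    \<comment> \<open>This is the bound sqrt (s^2 + w) \<le> s + w / (2 s) with w = t^2 - 2 s t cos
      \<theta>; the difference of the squares is a square.\<close>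
    have "(\<rho> (g t) (h s))\<^sup>2 \<le> (s + t\<^sup>2 / (2 * s) - t * cos \<theta>)\<^sup>2"
    proof -
      have "(s + t\<^sup>2 / (2 * s) - t * cos \<theta>)\<^sup>2 - (\<rho> (g t) (h s))\<^sup>2 = (t\<^sup>2 / (2 * s) - t * cos \<theta>)\<^sup>2"
        unfolding ce(3) using s by (simp add: field_simps power2_eq_square)
      moreover have "0 \<le> (t\<^sup>2 / (2 * s) - t * cos \<theta>)\<^sup>2" by simp
      ultimately show ?thesis by linarith
    qed
    moreover have "0 \<le> s + t\<^sup>2 / (2 * s) - t * cos \<theta>"
    proof -
      have "0 \<le> (s - t)\<^sup>2 / (2 * s)" using s by simp
      also have "\<dots> \<le> s + t\<^sup>2 / (2 * s) - t" using s by (simp add: field_simps power2_eq_square)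
      also have "\<dots> \<le> s + t\<^sup>2 / (2 * s) - t * cos \<theta>"
        using t mult_left_mono[OF cos_le_one[of \<theta>], of t] by simp
      finally show ?thesis .
    qed
    ultimately have 1: "\<rho> (g t) (h s) \<le> s + t\<^sup>2 / (2 * s) - t * cos \<theta>" by (rule power2_le_imp_le)
    have 2: "t * (cos \<alpha> - e / 2) \<le> t * cos \<theta>" using cth t by (intro mult_left_mono) auto
    have 3: "t\<^sup>2 / (2 * s) \<le> t * e / 2"
      using s t mult_left_mono[OF t(4), of t] by (simp add: field_simps power2_eq_square)
    have "\<rho> (g t) (h y) \<le> \<rho> (g t) (h s) + (y - s)" using m(4)[OF MM] r by simp
    then show ?thesis using 1 2 3 by (simp add: algebra_simps)
  qed
  have "\<forall>\<^sub>F t in at_right 0. t \<in> {0<..<min (min d x) (e * s)}"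
    using d pos e s by (intro eventually_at_right_real) simp
  then show ?thesis by eventually_elim (rule key, auto)
qed

lemma has_derivative_le_at_right:
  assumes u: "(u has_real_derivative u') (at 0)" and v: "(v has_real_derivative v') (at 0)"
    and eq: "u 0 = v 0" and le: "\<forall>\<^sub>F t in at_right 0. u t \<le> (v t :: real)"
  shows "u' \<le> v'"
proof (rule ccontr)
  assume "\<not> u' \<le> v'"
  then have n: "v' - u' < 0" by simp
  have "((\<lambda>t. v t - u t) has_real_derivative v' - u') (at 0)" using u v by (intro DERIV_diff)
  from DERIV_neg_dec_right[OF this n] obtain d where d: "0 < d"
    "\<And>h. 0 < h \<Longrightarrow> h < d \<Longrightarrow> v h - u h < 0" using eq by auto
  have "\<forall>\<^sub>F t in at_right 0. t \<in> {0<..<d}" using d by (intro eventually_at_right_real) simp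
  with le have "\<forall>\<^sub>F t in at_right (0::real). False"
    by eventually_elim (use d in fastforce)
  then show False by simp
qed

text \<open>The contrapositive is the descent: if \<beta> is too small, the model angle at the apex
  falls faster than c times the logarithm. First variation bounds the new third side from above,
  \<open>low\<close> bounds the new model angle from below, and the cosine law relates the two. The
  nonnegativity in \<open>low\<close> keeps the angles in [0, pi], where cos decreases.\<close>

lemma vertex_angle_comparison:
  assumes K: "K \<noteq> 0" and met: "metric_on M \<rho>"
    and g: "geodesic M \<rho> x g" and h: "geodesic M \<rho> z h" and hg: "h 0 = g x" "h z = Y"
    and pos: "0 < x" "0 < z"
    and ang: "upper_angle \<rho> (g x) (g ` {0..x}) (h ` {0..z}) = ereal \<beta>" "0 \<le> \<beta>" "\<beta> \<le> pi"
    and tri: "\<And>s. 0 < s \<Longrightarrow> s \<le> x \<Longrightarrow> model_triangle K s y (\<rho> (g s) Y)"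
    and c: "0 \<le> c"
    and low: "\<forall>\<^sub>F t in at_right 0. 0 \<le> model_angle K x y z + c * ln (1 - t / x) \<and>
       model_angle K x y z + c * ln (1 - t / x) \<le> model_angle K (x - t) y (\<rho> (g (x - t)) Y)"
  shows "cos \<beta> \<le> cos (model_angle K x z y) + c * cosh (sqrt \<bar>K\<bar> * x)"
proof (rule field_le_epsilon)
  fix e :: real assume e: "0 < e"
  define k where "k = sqrt \<bar>K\<bar>"
  have k: "0 < k" using K by (simp add: k_def)
  define F where "F = model_angle K x y z"
  have zz: "\<rho> (g x) Y = z" using geodesicD(3)[OF h, of 0 z] hg pos by simp
  have T: "model_triangle K x y z" using tri[of x] pos zz by simp
  note T' = model_triangle_rotate[OF T pos(2)]
  \<comment> \<open>\<open>w\<close> is the signed cosine of the first variation bound,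
    \<open>v\<close> is the cosine law with the angle replaced by its lower bound. The signed cosine
    of the true side lies between them for small t > 0, and they agree at t = 0, so the derivatives
    at 0 are comparable.\<close>
  define w where "w t = sgn K * cs K (z - t * (cos \<beta> - e))" for t
  define v where "v t = sgn K * cs K (x - t) * cs K y + sn K (x - t) * sn K y * cos (F + c * ln (1
      - t / x))" for t
  have sg: "sgn K * sgn K = 1" using K by (auto simp: sgn_if)
  have dw: "(w has_real_derivative sn K z * (k * (cos \<beta> - e))) (at 0)"
  proof -
    have "((\<lambda>t. sgn K * cs K (z - t * (cos \<beta> - e))) has_real_derivative
        sgn K * (- sgn K * sqrt \<bar>K\<bar> * sn K (z - 0 * (cos \<beta> - e)) * (- (cos \<beta> - e)))) (at 0)"
      by (intro DERIV_cmult cs_has_derivative K) (auto intro!: derivative_eq_intros)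
    also have "sgn K * (- sgn K * sqrt \<bar>K\<bar> * sn K (z - 0 * (cos \<beta> - e)) * (- (cos \<beta> - e)))
      = (sgn K * sgn K) * (sn K z * (k * (cos \<beta> - e)))"
        by (simp only: k_def) (simp add: algebra_simps)
    finally show ?thesis unfolding sg w_def[abs_def] by simp
  qed
  have dv: "(v has_real_derivative (k * (sn K x * cs K y - cs K x * (sn K y * cos F))
       + sn K x * (sn K y * sin F) * (c / x))) (at 0)"
  proof -
    have 0: "((\<lambda>t. x - t) has_real_derivative - 1) (at 0)" by (auto intro!: derivative_eq_intros)
    have 1: "((\<lambda>t. cs K (x - t)) has_real_derivative sgn K * k * sn K x) (at 0)"
      using cs_has_derivative[OF K 0] by (simp add: k_def)
    have 2: "((\<lambda>t. sn K (x - t)) has_real_derivative - (k * cs K x)) (at 0)"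
      using sn_has_derivative[OF 0, of K] by (simp add: k_def)
    have 3: "((\<lambda>t. cos (F + c * ln (1 - t / x))) has_real_derivative sin F * (c / x)) (at 0)"
      using pos by (auto intro!: derivative_eq_intros)
    have "(v has_real_derivative (sgn K * (sgn K * k * sn K x)) * cs K y
       + ((- (k * cs K x) * sn K y) * cos (F + c * ln (1 - 0 / x)) + sin F * (c / x) * (sn K (x
           - 0) * sn K y))) (at 0)"
      unfolding v_def[abs_def]
      by (intro DERIV_add DERIV_mult DERIV_cmult DERIV_cmult_right 1 2 3)
    also have "(sgn K * (sgn K * k * sn K x)) * cs K y
       + ((- (k * cs K x) * sn K y) * cos (F + c * ln (1 - 0 / x)) + sin F * (c / x) * (sn K (x
           - 0) * sn K y))
       = (sgn K * sgn K) * (k * (sn K x * cs K y)) - k * (cs K x * (sn K y * cos F))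
           + sn K x * (sn K y * sin F) * (c / x)"
      by (simp only: ac_simps) (simp add: algebra_simps)
    finally show ?thesis unfolding sg by (simp add: algebra_simps)
  qed
  have eq: "w 0 = v 0"
    using cos_model_angle[OF K T] by (simp add: w_def v_def F_def algebra_simps)
  have "\<forall>\<^sub>F t in at_right 0. w t \<le> v t"
  proof -
    have rev: "geodesic M \<rho> x (\<lambda>t. g (x - t))" by (rule geodesic_reverse[OF g])
    have fv: "\<forall>\<^sub>F t in at_right 0. \<rho> (g (x - t)) Y \<le> z - t * (cos \<beta> - e)"
      using first_variation[OF met rev h, of "g x" \<beta> e] hg pos ang e by (simp add: reverse_image)
    \<comment> \<open>The signed cosine decreases only up to \<open>pi / sqrt K\<close>; since z
      lies strictly below, the perturbed length does so too for small t.\<close>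
    have zpi: "\<forall>\<^sub>F t in at_right 0. K > 0 \<longrightarrow> z - t * (cos \<beta> - e) < pi / sqrt K"
    proof (cases "K > 0")
      case True
      have "((\<lambda>t. z - t * (cos \<beta> - e)) \<longlongrightarrow> z - 0 * (cos \<beta> - e)) (at_right 0)"
        by (intro tendsto_intros)
      then have "\<forall>\<^sub>F t in at_right 0. z - t * (cos \<beta> - e) < pi / sqrt K"
        using model_triangle_less_pi(3)[OF T True] by (intro order_tendstoD(2)) auto
      then show ?thesis by eventually_elim simp
    qed simp
    have tx: "\<forall>\<^sub>F t in at_right 0. t \<in> {0<..<x}" using pos by (intro eventually_at_right_real)
    show ?thesis using fv zpi tx low
    proof eventually_elim
      case (elim t)
      define zt where "zt = \<rho> (g (x - t)) Y"
      have Tt: "model_triangle K (x - t) y zt" using tri[of "x - t"] elim by (simp add: zt_def)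
      have "w t \<le> sgn K * cs K zt" unfolding w_def
        using elim Tt by (intro sgn_cs_antimono K) (auto simp: zt_def model_triangle_def
            less_imp_le)
      also have "\<dots> = sgn K * cs K (x - t) * cs K y + sn K (x - t) * sn K y * cos (model_angle K (x
          - t) y zt)"
        unfolding cos_model_angle[OF K Tt] by (simp add: algebra_simps)
      also have "\<dots> \<le> v t"
      proof -
        have "cos (model_angle K (x - t) y zt) \<le> cos (F + c * ln (1 - t / x))"
          using elim model_angle_bounds[OF K Tt] by (intro cos_monotone_0_pi_le) (auto simp: F_def
              zt_def)
        then show ?thesis unfolding v_def using model_triangle_sn_pos[OF K Tt]
          by (intro add_left_mono mult_left_mono) auto
      qed
      finally show ?case .
    qed
  qed
  from has_derivative_le_at_right[OF dw dv eq this]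
  have "sn K z * (k * (cos \<beta> - e)) \<le> k * (sn K x * cs K y - cs K x * (sn K y * cos F))
       + sn K x * (sn K y * sin F) * (c / x)" .
  \<comment> \<open>The part with frozen angle is the projection formula, the part from the moving
    angle is the sine law. Both carry the factor \<open>sn K z\<close>, which then cancels.\<close>
  also have "\<dots> = sn K z * (k * cos (model_angle K x z y)
      + sn K x * sin (model_angle K x z y) * (c / x))"
    unfolding F_def model_projection[OF K T pos(2)] model_sine_law[OF K T pos(2)]
      by (simp add: algebra_simps)
  finally have "k * (cos \<beta> - e) \<le> k * cos (model_angle K x z y)
      + sn K x * sin (model_angle K x z y) * (c / x)"
    using model_triangle_sn_pos(2)[OF K T'] by simp
  also have "sn K x * sin (model_angle K x z y) * (c / x) \<le> sn K x * 1 * (c / x)"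
    using model_triangle_sn_pos(1)[OF K T] c pos by (intro mult_right_mono mult_left_mono) auto
  also have "sn K x * 1 * (c / x) \<le> k * x * cosh (k * x) * (c / x)"
    using sn_le[OF pos(1), of K] c pos by (intro mult_right_mono) (auto simp: k_def)
  also have "\<dots> = k * (c * cosh (k * x))" using pos by simp
  finally have "k * (cos \<beta> - e) \<le> k * (cos (model_angle K x z y) + c * cosh (k * x))"
    by (simp add: algebra_simps)
  then show "cos \<beta> \<le> cos (model_angle K x z y) + c * cosh (sqrt \<bar>K\<bar> * x) + e"
    using k by (simp add: k_def)
qed

subsection \<open>Angle comparison\<close>

lemma continuous_on_cs [continuous_intros]:
  fixes f :: "'a::t2_space \<Rightarrow> real"
  shows "continuous_on S f \<Longrightarrow> continuous_on S (\<lambda>x. cs K (f x))"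
  unfolding cs_def by (cases "K > 0") (auto intro!: continuous_intros)

lemma continuous_on_sn [continuous_intros]:
  fixes f :: "'a::t2_space \<Rightarrow> real"
  shows "continuous_on S f \<Longrightarrow> continuous_on S (\<lambda>x. sn K (f x))"
  unfolding sn_def by (cases "K > 0") (auto intro!: continuous_intros)

lemma Rk_domainD:
  assumes "Rk_domain K M \<rho>"
  shows "metric_on M \<rho>"
    and "\<And>X Y. X \<in> M \<Longrightarrow> Y \<in> M \<Longrightarrow> \<exists>S. is_shortest M \<rho> X Y S"
    and "\<And>A B C Sab Sbc Sca. A \<in> M \<Longrightarrow> B \<in> M \<Longrightarrow> C \<in> M \<Longrightarrow> A \<noteq> B \<Longrightarrow> B \<noteq> C \<Longrightarrow> A \<noteq> C \<Longrightarrow>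
        is_shortest M \<rho> A B Sab \<Longrightarrow> is_shortest M \<rho> B C Sbc \<Longrightarrow> is_shortest M \<rho> C A Sca \<Longrightarrow>
          (K > 0 \<longrightarrow> \<rho> A B + \<rho> B C + \<rho> C A < 2 * pi / sqrt K) \<and>
          upper_angle \<rho> A Sab Sca + upper_angle \<rho> B Sab Sbc + upper_angle \<rho> C Sbc Sca
            \<le> ereal (angle_K K \<rho> B A C + angle_K K \<rho> A B C + angle_K K \<rho> A C B)"
  using assms unfolding Rk_domain_def by blast+

lemma Rk_domain_model_triangle:
  assumes R: "Rk_domain K M \<rho>" and M: "Q \<in> M" "X \<in> M" "Y \<in> M" and ne: "X \<noteq> Q" "Y \<noteq> Q" "X \<noteq> Y"
  shows "model_triangle K (\<rho> Q X) (\<rho> Q Y) (\<rho> X Y)"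
proof -
  note met = Rk_domainD(1)[OF R]
  note m = metric_onD[OF met]
  obtain S1 S2 S3 where S: "is_shortest M \<rho> Q X S1" "is_shortest M \<rho> X Y S2"
      "is_shortest M \<rho> Y Q S3"
    using Rk_domainD(2)[OF R] M by meson
  have "K > 0 \<longrightarrow> \<rho> Q X + \<rho> X Y + \<rho> Y Q < 2 * pi / sqrt K"
    using Rk_domainD(3)[OF R M _ _ _ S] ne by blast
  then show ?thesis
    using metric_on_pos[OF met M(1,2)] metric_on_pos[OF met M(1,3)] ne
      m(4)[of X Q Y] m(4)[of Q Y X] m(4)[of Q X Y] m(3)[of Q X] m(3)[of X Y] m(3)[of Y Q] M
    by (auto simp: model_triangle_def abs_le_iff)
qed

text \<open>If an angle \<open>\<alpha>\<close> of a triangle exceeded its model angle, then by the angle sum condition one of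
  the other two angles would be smaller than its model angle by a definite amount, and the first
  variation inequality would let the model angle \<open>f x y\<close> at \<open>Q\<close> decrease at a definite rate in
  \<open>ln x\<close> or in \<open>ln y\<close> when the corresponding vertex moves towards \<open>Q\<close>. This is impossible at a
  minimum of \<open>f x y - c * (ln x + ln y)\<close>, which exists since \<open>f\<close> is bounded below.\<close>

lemma upper_angle_le_model_angle:
  assumes K: "K \<noteq> 0" and R: "Rk_domain K M \<rho>"
    and g: "geodesic M \<rho> a g" and h: "geodesic M \<rho> b h" and Q: "g 0 = Q" "h 0 = Q"
    and pos: "0 < a" "0 < b" and ne: "g a \<noteq> h b"
  shows "upper_angle \<rho> Q (g ` {0..a}) (h ` {0..b}) \<le> ereal (model_angle K a b (\<rho> (g a) (h b)))"
proof -
  note met = Rk_domainD(1)[OF R]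
  note m = metric_onD[OF met] and gd = geodesicD[OF g] and hd = geodesicD[OF h]
  have QM: "Q \<in> M" using gd(2)[of 0] Q pos by simp
  obtain \<alpha> where \<alpha>: "upper_angle \<rho> Q (g ` {0..a}) (h ` {0..b}) = ereal \<alpha>" "0 \<le> \<alpha>" "\<alpha> \<le> pi"
    by (rule upper_angle_real[OF met g h Q pos])
  define z where "z x y = \<rho> (g x) (h y)" for x y
  define f where "f x y = model_angle K x y (z x y)" for x y
  \<comment> \<open>One bound for the factors cosh of both vertices at all x \<le> a and y \<le> b,
    so that c can be chosen before the minimum is located.\<close>
  define B where "B = cosh (sqrt \<bar>K\<bar> * (a + b))"
  have B: "cosh (sqrt \<bar>K\<bar> * x) \<le> B" if "0 \<le> x" "x \<le> a + b" for x
    using that by (simp add: B_def cosh_real_nonneg_le_iff mult_left_mono)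
  have B1: "1 \<le> B" unfolding B_def by (rule cosh_real_ge_1)
  have rQ: "\<rho> Q (g x) = x" "\<rho> Q (h y) = y" if "0 \<le> x" "x \<le> a" "0 \<le> y" "y \<le> b" for x y
    using gd(3)[of 0 x] hd(3)[of 0 y] Q that by auto
  have QQ: "\<rho> Q Q = 0" using m(2) QM by blast
  \<comment> \<open>The domain condition speaks only of three distinct points, and
    \<open>g x\<close> may equal \<open>h y\<close>. The perimeter bound is therefore inherited from
    the large triangle by the triangle inequality.\<close>
  have tri: "model_triangle K x y (z x y)" if "0 < x" "x \<le> a" "0 < y" "y \<le> b" for x y
  proof -
    have M: "g x \<in> M" "h y \<in> M" "g a \<in> M" "h b \<in> M" using gd(2) hd(2) that by auto
    have nQ: "g a \<noteq> Q" "h b \<noteq> Q" using rQ[of a b] pos QQ by auto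
    have 1: "model_triangle K a b (z a b)"
      using Rk_domain_model_triangle[OF R QM M(3,4) nQ ne] rQ[of a b] pos by (simp add: z_def)
    have 2: "\<rho> (g x) (g a) = a - x" "\<rho> (h b) (h y) = b - y"
      using gd(3)[of x a] hd(3)[of b y] that by auto
    have 3: "z x y \<le> (a - x) + z a b + (b - y)"
      using m(4)[OF M(1,3,2)] m(4)[OF M(3,4,2)] 2 by (simp add: z_def)
    show ?thesis
      using 1 3 that rQ[of x y] m(4)[OF M(1) QM M(2)] m(4)[OF QM M(2,1)] m(4)[OF QM M(1,2)]
        m(3)[OF QM M(1)] m(3)[OF M(1,2)]
      by (auto simp: model_triangle_def abs_le_iff z_def)
  qed
  have f_bounds: "0 \<le> f x y" "f x y \<le> pi" if "0 < x" "x \<le> a" "0 < y" "y \<le> b" for x y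
    using model_angle_bounds[OF K tri[OF that]] by (auto simp: f_def)
  \<comment> \<open>No pair with excess at least \<eta> can resist the descent in both variables.
    The lower bounds are hypotheses, with c = 0 allowed, so that the same argument serves an
    interior minimum and a zero of \<open>f\<close>.\<close>
  have stuck: False
    if xy: "0 < x" "x \<le> a" "0 < y" "y \<le> b" and gh: "g x \<noteq> h y"
      and c: "0 \<le> c" "c * B < 2 * (sin (\<eta> / 4))\<^sup>2" and \<eta>: "0 < \<eta>" "\<eta> \<le> \<alpha> - f x y"
      and lowx: "\<forall>\<^sub>F t in at_right 0. 0 \<le> f x y + c * ln (1 - t / x) \<and> f x y + c * ln (1 - t / x)
          \<le> f (x - t) y"
      and lowy: "\<forall>\<^sub>F t in at_right 0. 0 \<le> f x y + c * ln (1 - t / y) \<and> f x y + c * ln (1 - t / y)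
          \<le> f x (y - t)"
    for x y c \<eta>
  proof -
    have M: "g x \<in> M" "h y \<in> M" using gd(2) hd(2) xy by auto
    have gx: "geodesic M \<rho> x g" and hy: "geodesic M \<rho> y h"
      using geodesic_restrict[OF g] geodesic_restrict[OF h] xy by auto
    obtain S where S: "is_shortest M \<rho> (g x) (h y) S" using Rk_domainD(2)[OF R M] by blast
    obtain u where u: "geodesic M \<rho> (z x y) u" "u 0 = g x" "u (z x y) = h y" "S = u ` {0..z x y}"
      using shortest_imp_geodesic[OF met S] unfolding z_def by blast
    have zp: "0 < z x y" using metric_on_pos[OF met M gh] by (simp add: z_def)
    have nQ: "g x \<noteq> Q" "h y \<noteq> Q" using rQ[of x y] xy QQ by auto
    have S1: "is_shortest M \<rho> Q (g x) (g ` {0..x})" using geodesic_imp_shortest[OF gx] Q by simp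
    have S2: "is_shortest M \<rho> (h y) Q (h ` {0..y})"
      using geodesic_imp_shortest_reverse[OF hy] Q by simp
    note rg = geodesic_reverse[OF gx] and rh = geodesic_reverse[OF hy] and ru
        = geodesic_reverse[OF u(1)]
    obtain \<beta> where \<beta>: "upper_angle \<rho> (g x) (g ` {0..x}) S = ereal \<beta>" "0 \<le> \<beta>" "\<beta> \<le> pi"
      using upper_angle_real[OF met rg u(1), of "g x"] u xy zp by (auto simp: reverse_image)
    obtain \<gamma> where \<gamma>: "upper_angle \<rho> (h y) (h ` {0..y}) S = ereal \<gamma>" "0 \<le> \<gamma>" "\<gamma> \<le> pi"
      using upper_angle_real[OF met rh ru, of "h y"] u xy zp by (auto simp: reverse_image)
    have sub: "S \<subseteq> M" "h ` {0..y} \<subseteq> M" using u hy unfolding geodesic_def by auto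
    have "ereal \<alpha> \<le> upper_angle \<rho> Q (g ` {0..x}) (h ` {0..y})"
      unfolding \<alpha>(1)[symmetric]
    proof (rule upper_angle_local_mono[of "min x y"])
      show "0 < min x y" using xy by simp
      show "X \<in> g ` {0..x}" if "X \<in> g ` {0..a}" "\<rho> Q X < min x y" for X
        using that rQ(1)[of _ 0] pos by auto
      show "Y \<in> h ` {0..y}" if "Y \<in> h ` {0..b}" "\<rho> Q Y < min x y" for Y
        using that rQ(2)[of 0] pos by auto
    qed
    moreover have "upper_angle \<rho> Q (g ` {0..x}) (h ` {0..y}) + upper_angle \<rho> (g x) (g ` {0..x}) S
       + upper_angle \<rho> (h y) S (h ` {0..y})
       \<le> ereal (angle_K K \<rho> (g x) Q (h y) + angle_K K \<rho> Q (g x) (h y) + angle_K K \<rho> Q (h y) (g x))"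
      using Rk_domainD(3)[OF R QM M _ _ _ S1 S S2] nQ gh by blast
    moreover have "upper_angle \<rho> (h y) S (h ` {0..y}) = ereal \<gamma>"
      using upper_angle_commute[OF met sub] \<gamma> by simp
    moreover have "angle_K K \<rho> (g x) Q (h y) = f x y" "angle_K K \<rho> Q (g x) (h y)
        = model_angle K x (z x y) y"
      "angle_K K \<rho> Q (h y) (g x) = model_angle K y (z x y) x"
      using rQ[of x y] xy m(3)[OF M] m(3)[OF QM M(1)] m(3)[OF QM M(2)]
        by (auto simp: angle_K_def f_def z_def)
    ultimately have "ereal \<alpha> + ereal \<beta> + ereal \<gamma>
        \<le> ereal (f x y + model_angle K x (z x y) y + model_angle K y (z x y) x)"
      using \<beta>(1) by (metis (no_types, lifting) add_right_mono order_trans)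
    then have sum: "\<alpha> + \<beta> + \<gamma> \<le> f x y + model_angle K x (z x y) y + model_angle K y (z x y) x"
      by simp
    have sym: "z s t = \<rho> (h t) (g s)" if "0 \<le> s" "s \<le> a" "0 \<le> t" "t \<le> b" for s t
      using m(3) gd(2) hd(2) that by (simp add: z_def)
    have T1: "model_triangle K x y (z x y)" using tri xy by simp
    have T2: "model_triangle K y x (z x y)" using T1 by (simp add: model_triangle_commute)
    have "cos \<beta> \<le> cos (model_angle K x (z x y) y) + c * cosh (sqrt \<bar>K\<bar> * x)"
    proof (rule vertex_angle_comparison[OF K met gx u(1,2,3) xy(1) zp _ \<beta>(2,3) _ c(1)])
      show "upper_angle \<rho> (g x) (g ` {0..x}) (u ` {0..z x y}) = ereal \<beta>" using \<beta> u by simp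
      show "model_triangle K s y (\<rho> (g s) (h y))" if "0 < s" "s \<le> x" for s
        using tri[of s y] that xy by (simp add: z_def)
      show "\<forall>\<^sub>F t in at_right 0. 0 \<le> model_angle K x y (z x y) + c * ln (1 - t / x) \<and>
         model_angle K x y (z x y) + c * ln (1 - t / x)
             \<le> model_angle K (x - t) y (\<rho> (g (x - t)) (h y))"
        using lowx by (simp add: f_def z_def)
    qed
    also have "\<dots> \<le> cos (model_angle K x (z x y) y) + c * B"
      using B[of x] xy pos c by (simp add: mult_left_mono)
    finally have 1: "cos \<beta> \<le> cos (model_angle K x (z x y) y) + c * B" .
    \<comment> \<open>The other vertex is treated by exchanging the two sides and running the third
      side backwards, so that it starts at \<open>h y\<close>.\<close>
    have "cos \<gamma> \<le> cos (model_angle K y (z x y) x) + c * cosh (sqrt \<bar>K\<bar> * y)"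
    proof (rule vertex_angle_comparison[OF K met hy ru _ _ xy(3) zp _ \<gamma>(2,3) _ c(1)])
      show "u (z x y - 0) = h y" "u (z x y - z x y) = g x" using u by auto
      show "upper_angle \<rho> (h y) (h ` {0..y}) ((\<lambda>t. u (z x y - t)) ` {0..z x y}) = ereal \<gamma>"
        using \<gamma> u by (simp add: reverse_image)
      show "model_triangle K s x (\<rho> (h s) (g x))" if "0 < s" "s \<le> y" for s
        using tri[of x s] that xy sym[of x s] by (simp add: model_triangle_commute)
      have "\<forall>\<^sub>F t in at_right 0. t \<in> {0<..<y}" using xy by (intro eventually_at_right_real)
      with lowy show "\<forall>\<^sub>F t in at_right 0. 0 \<le> model_angle K y x (z x y) + c * ln (1 - t / y) \<and>
         model_angle K y x (z x y) + c * ln (1 - t / y)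
             \<le> model_angle K (y - t) x (\<rho> (h (y - t)) (g x))"
      proof eventually_elim
        case (elim t)
        then show ?case
          using sym[of x "y - t"] xy model_angle_commute[of K y x] model_angle_commute[of K
              "y - t" x]
          by (simp add: f_def)
      qed
    qed
    also have "\<dots> \<le> cos (model_angle K y (z x y) x) + c * B"
      using B[of y] xy pos c by (simp add: mult_left_mono)
    finally have 2: "cos \<gamma> \<le> cos (model_angle K y (z x y) x) + c * B" .
    show False
      by (rule angle_sum_contradiction[OF sum \<eta> c(2) \<beta>(2) _ \<gamma>(2) _ 1 2])
        (use model_angle_bounds(2)[OF K model_triangle_rotate[OF T1 zp]]
          model_angle_bounds(2)[OF K model_triangle_rotate[OF T2 zp]] in auto)
  qed
  have "\<alpha> \<le> f a b"
  proof (rule ccontr)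
    assume "\<not> \<alpha> \<le> f a b"
    define \<eta> where "\<eta> = \<alpha> - f a b"
    have fab: "0 \<le> f a b" using f_bounds[of a b] pos by simp
    have \<eta>: "0 < \<eta>" "\<eta> \<le> pi" using \<open>\<not> \<alpha> \<le> f a b\<close> fab \<alpha> by (auto simp: \<eta>_def)
    have s: "0 < sin (\<eta> / 4)" using \<eta> by (intro sin_gt_zero) auto
    \<comment> \<open>A zero is an absolute minimum of \<open>f\<close>, so the lower bounds hold
      with c = 0; the excess there is \<alpha>, which is at least \<eta>.\<close>
    have stuck0: False
      if xy: "0 < x" "x \<le> a" "0 < y" "y \<le> b" and gh: "g x \<noteq> h y" and f0: "f x y = 0" for x y
    proof (rule stuck[OF xy gh, of 0 \<eta>])
      show "(0::real) \<le> 0" "0 * B < 2 * (sin (\<eta> / 4))\<^sup>2" "0 < \<eta>" using s \<eta> by auto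
      show "\<eta> \<le> \<alpha> - f x y" using f0 fab by (simp add: \<eta>_def)
      have "\<forall>\<^sub>F t in at_right 0. t \<in> {0<..<x}" using xy by (intro eventually_at_right_real)
      then show "\<forall>\<^sub>F t in at_right 0. 0 \<le> f x y + 0 * ln (1 - t / x) \<and> f x y + 0 * ln (1 - t / x)
          \<le> f (x - t) y"
        by eventually_elim (use f0 xy f_bounds in auto)
      have "\<forall>\<^sub>F t in at_right 0. t \<in> {0<..<y}" using xy by (intro eventually_at_right_real)
      then show "\<forall>\<^sub>F t in at_right 0. 0 \<le> f x y + 0 * ln (1 - t / y) \<and> f x y + 0 * ln (1 - t / y)
          \<le> f x (y - t)"
        by eventually_elim (use f0 xy f_bounds in auto)
    qed
    \<comment> \<open>Half of the largest value that the contradiction tolerates.\<close>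
    define c where "c = (sin (\<eta> / 4))\<^sup>2 / B"
    have c: "0 < c" "c * B < 2 * (sin (\<eta> / 4))\<^sup>2" using s B1 by (auto simp: c_def)
    \<comment> \<open>Comparing a minimum of \<phi> with the value at (a, b) gives x \<ge> a exp (-
      f a b / c), and likewise for y. Half of this factor keeps the minimum off the lower faces of
      the box, so that both coordinates can still be decreased.\<close>
    define l where "l = exp (- f a b / c) / 2"
    have "0 < exp (- f a b / c)" "exp (- f a b / c) \<le> 1" using fab c by simp_all
    then have l: "0 < l" "l \<le> 1" unfolding l_def by linarith+
    define \<phi> where "\<phi> p = f (fst p) (snd p) - c * (ln (fst p) + ln (snd p))" for p
    define box where "box = {l * a..a} \<times> {l * b..b}"
    have box: "0 < fst p \<and> fst p \<le> a \<and> 0 < snd p \<and> snd p \<le> b" if "p \<in> box" for p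
    proof -
      have "0 < l * a" "0 < l * b" using l pos by auto
      then show ?thesis using that unfolding box_def by (auto simp: mem_Times_iff)
    qed
    have ab: "(a, b) \<in> box" using l pos by (auto simp: box_def mult_le_cancel_right1)
    \<comment> \<open>\<open>z\<close> is 1-Lipschitz in each variable by the triangle
      inequality.\<close>
    have zcont: "continuous_on box (\<lambda>p. z (fst p) (snd p))"
      unfolding continuous_on_iff
    proof (intro ballI allI impI)
      fix p :: "real \<times> real" and e :: real assume p: "p \<in> box" and e: "0 < e"
      show "\<exists>d>0. \<forall>q\<in>box. dist q p < d \<longrightarrow> dist (z (fst q) (snd q)) (z (fst p) (snd p)) < e"
      proof (intro exI[of _ "e / 2"] conjI ballI impI)
        fix q assume q: "q \<in> box" and d: "dist q p < e / 2"
        have M: "g (fst p) \<in> M" "h (snd p) \<in> M" "g (fst q) \<in> M" "h (snd q) \<in> M"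
          using gd(2) hd(2) box[OF p] box[OF q] by auto
        have r: "\<rho> (g (fst p)) (g (fst q)) = \<bar>fst p - fst q\<bar>" "\<rho> (h (snd p)) (h (snd q))
            = \<bar>snd p - snd q\<bar>"
          using gd(3)[of "fst p" "fst q"] hd(3)[of "snd p" "snd q"] box[OF p] box[OF q] by auto
        have "\<bar>fst p - fst q\<bar> < e / 2" "\<bar>snd p - snd q\<bar> < e / 2"
          using dist_fst_le[of p q] dist_snd_le[of p q] d by (auto simp: dist_real_def dist_commute)
        then show "dist (z (fst q) (snd q)) (z (fst p) (snd p)) < e"
          using m(4)[OF M(1,3,2)] m(4)[OF M(3,4,2)] m(4)[OF M(3,1,4)] m(4)[OF M(1,2,4)]
            m(3)[OF M(1,3)] m(3)[OF M(2,4)] r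
          unfolding z_def dist_real_def by linarith
      qed (use e in simp)
    qed
    define R where "R p = sgn K * (cs K (z (fst p) (snd p)) - cs K (fst p) * cs K (snd p))
      / (sn K (fst p) * sn K (snd p))" for p
    have box_tri: "model_triangle K (fst p) (snd p) (z (fst p) (snd p))" if "p \<in> box" for p
      using tri box[OF that] by blast
    have "continuous_on box R"
      unfolding R_def
    proof (intro continuous_intros zcont ballI)
      fix p assume "p \<in> box"
      then show "sn K (fst p) * sn K (snd p) \<noteq> 0"
        using model_triangle_sn_pos[OF K box_tri, of p] by simp
    qed
    moreover have "- 1 \<le> R p \<and> R p \<le> 1" if "p \<in> box" for p
      using model_cos_bounds[OF K box_tri[OF that]] unfolding R_def abs_le_iff by linarith
    ultimately have "continuous_on box (\<lambda>p. arccos (R p))"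
      by (intro continuous_on_arccos) auto
    moreover have "continuous_on box (\<lambda>p. c * (ln (fst p) + ln (snd p)))"
    proof (intro continuous_intros ballI)
      fix p assume "p \<in> box"
      then show "fst p \<noteq> 0" "snd p \<noteq> 0" using box[of p] by auto
    qed
    moreover have "\<phi> = (\<lambda>p. arccos (R p) - c * (ln (fst p) + ln (snd p)))"
      unfolding \<phi>_def f_def model_angle_eq[OF K] R_def ..
    ultimately have "continuous_on box \<phi>" by (simp only: continuous_on_diff)
    moreover have "compact box" unfolding box_def by (intro compact_Times compact_Icc)
    ultimately obtain p where p: "p \<in> box" "\<And>q. q \<in> box \<Longrightarrow> \<phi> p \<le> \<phi> q"
      using continuous_attains_inf[of box \<phi>] ab by blast
    define x y where "x = fst p" and "y = snd p"
    have xy: "0 < x" "x \<le> a" "0 < y" "y \<le> b" using box[OF p(1)] by (auto simp: x_def y_def)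
    have fxy: "0 \<le> f x y" using f_bounds xy by simp
    have lnle: "ln x \<le> ln a" "ln y \<le> ln b" using xy by auto
    have "f x y - c * (ln x + ln y) \<le> f a b - c * (ln a + ln b)"
      using p(2)[OF ab] by (simp add: \<phi>_def x_def y_def)
    then have est: "f x y + c * (ln a - ln x) + c * (ln b - ln y) \<le> f a b"
      by (simp add: algebra_simps)
    have cnn: "0 \<le> c * (ln a - ln x)" "0 \<le> c * (ln b - ln y)" using c lnle by auto
    have away: "l * r < v" if "0 < r" "0 < v" "c * (ln r - ln v) \<le> f a b" for r v
    proof -
      have "ln r - ln v \<le> f a b / c" using that c by (simp add: pos_le_divide_eq mult.commute)
      then have "ln (r * exp (- f a b / c)) \<le> ln v" using that by (simp add: ln_mult)
      then have "r * exp (- f a b / c) \<le> v" using that by (subst (asm) ln_le_cancel_iff) auto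
      moreover have "0 < r * exp (- f a b / c)" using that by simp
      moreover have "l * r = r * exp (- f a b / c) / 2" by (simp add: l_def)
      ultimately show ?thesis by linarith
    qed
    have lx: "l * a < x" and ly: "l * b < y"
      using away[of a x] away[of b y] est cnn fxy pos xy by auto
    show False
    proof (cases "g x = h y")
      \<comment> \<open>When the cut points coincide there is no triangle. Halving x gives the
        degenerate triangle with sides x / 2, x and x / 2, whose model angle at \<open>Q\<close> is
        0, so the case of a zero applies.\<close>
      case True
      then have "x = y" using rQ[of x y] xy by simp
      have "z (x / 2) x = \<bar>x / 2 - x\<bar>"
        using True \<open>x = y\<close> gd(3)[of "x / 2" x] xy by (simp add: z_def)
      moreover have "model_triangle K (x / 2) x (z (x / 2) x)" using tri xy \<open>x = y\<close> by simp
      ultimately have "f (x / 2) x = 0" unfolding f_def using model_angle_eq_0[OF K] by metis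
      moreover have "g (x / 2) \<noteq> h x"
        using rQ[of "x / 2" x] xy \<open>x = y\<close> by auto
      ultimately show False using stuck0[of "x / 2" x] xy \<open>x = y\<close> by simp
    next
      case gh: False
      show False
      \<comment> \<open>The logarithmic lower bound stays nonnegative for small t only if it starts
        from a positive value.\<close>
      proof (cases "f x y = 0")
        case True
        then show False using stuck0 xy gh by blast
      next
        case False
        then have fp: "0 < f x y" using fxy by simp
        have near: "\<forall>\<^sub>F t in at_right 0. 0 \<le> f x y + c * ln (1 - t / r)" if "0 < r" for r
        proof -
          have "((\<lambda>t. f x y + c * ln (1 - t / r)) \<longlongrightarrow> f x y + c * ln (1 - 0 / r)) (at_right 0)"
            using that by (intro tendsto_intros) auto
          then have "\<forall>\<^sub>F t in at_right 0. 0 < f x y + c * ln (1 - t / r)"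
            using fp by (intro order_tendstoD(1)) auto
          then show ?thesis by eventually_elim simp
        qed
        have lnd: "ln (1 - t / r) = ln (r - t) - ln r" if "0 < t" "t < r" for r t :: real
        proof -
          have "1 - t / r = (r - t) / r" using that by (simp add: field_simps)
          then show ?thesis using that by (simp add: ln_div)
        qed
        show False
        proof (rule stuck[OF xy gh _ c(2) \<eta>(1)])
          show "0 \<le> c" using c by simp
          show "\<eta> \<le> \<alpha> - f x y" using est cnn by (simp add: \<eta>_def)
          have "\<forall>\<^sub>F t in at_right 0. t \<in> {0<..<x - l * a}"
            using lx by (intro eventually_at_right_real) simp
          with near[OF xy(1)] show "\<forall>\<^sub>F t in at_right 0. 0 \<le> f x y + c * ln (1 - t / x) \<and>
              f x y + c * ln (1 - t / x) \<le> f (x - t) y"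
          proof eventually_elim
            case (elim t)
            have "0 < l * a" using l pos by simp
            then have t: "0 < t" "t < x" using elim by auto
            have "(x - t, y) \<in> box" using elim xy ly by (auto simp: box_def)
            \<comment> \<open>Minimality of \<phi> in the direction of decreasing x is the required
              bound, because ln (x - t) - ln x = ln (1 - t / x).\<close>
            from p(2)[OF this] have "f x y - c * (ln x + ln y)
                \<le> f (x - t) y - c * (ln (x - t) + ln y)"
              by (simp add: \<phi>_def x_def y_def)
            then show ?case using elim unfolding lnd[OF t] by (simp add: algebra_simps)
          qed
          have "\<forall>\<^sub>F t in at_right 0. t \<in> {0<..<y - l * b}"
            using ly by (intro eventually_at_right_real) simp
          with near[OF xy(3)] show "\<forall>\<^sub>F t in at_right 0. 0 \<le> f x y + c * ln (1 - t / y) \<and>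
              f x y + c * ln (1 - t / y) \<le> f x (y - t)"
          proof eventually_elim
            case (elim t)
            have "0 < l * b" using l pos by simp
            then have t: "0 < t" "t < y" using elim by auto
            have "(x, y - t) \<in> box" using elim xy lx by (auto simp: box_def)
            from p(2)[OF this] have "f x y - c * (ln x + ln y)
                \<le> f x (y - t) - c * (ln x + ln (y - t))"
              by (simp add: \<phi>_def x_def y_def)
            then show ?case using elim unfolding lnd[OF t] by (simp add: algebra_simps)
          qed
        qed
      qed
    qed
  qed
  then show ?thesis by (simp add: \<alpha>(1) f_def z_def)
qed

subsection \<open>Median comparison\<close>

text \<open>For angles in [0, pi] this says \<alpha> + \<beta> \<ge> pi. Moving along
  \<open>n\<close> changes the distances to the two ends by at most - t cos \<alpha> and - t cos
  \<beta> to first order, while their sum cannot drop below x + y.\<close>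

lemma cos_adjacent_upper_angles:
  assumes met: "metric_on M \<rho>" and g: "geodesic M \<rho> x g" and h: "geodesic M \<rho> y h" and n:
      "geodesic M \<rho> r n"
    and Q: "g 0 = Q" "h 0 = Q" "n 0 = Q" and pos: "0 < x" "0 < y" "0 < r"
    and straight: "\<rho> (g x) (h y) = x + y"
    and \<alpha>: "upper_angle \<rho> Q (g ` {0..x}) (n ` {0..r}) = ereal \<alpha>" "0 \<le> \<alpha>" "\<alpha> \<le> pi"
    and \<beta>: "upper_angle \<rho> Q (h ` {0..y}) (n ` {0..r}) = ereal \<beta>" "0 \<le> \<beta>" "\<beta> \<le> pi"
  shows "cos \<alpha> + cos \<beta> \<le> 0"
proof (rule field_le_epsilon)
  fix e :: real assume e: "0 < e"
  note m = metric_onD[OF met]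
  have sub: "g ` {0..x} \<subseteq> M" "h ` {0..y} \<subseteq> M" "n ` {0..r} \<subseteq> M"
    using g h n unfolding geodesic_def by auto
  have 1: "\<forall>\<^sub>F t in at_right 0. \<rho> (n t) (g x) \<le> x - t * (cos \<alpha> - e / 2)"
    by (rule first_variation[OF met n g Q(3,1) pos(3,1) _ \<alpha>(2,3)])
      (use \<alpha> upper_angle_commute[OF met sub(3,1)] e in auto)
  have 2: "\<forall>\<^sub>F t in at_right 0. \<rho> (n t) (h y) \<le> y - t * (cos \<beta> - e / 2)"
    by (rule first_variation[OF met n h Q(3,2) pos(3,2) _ \<beta>(2,3)])
      (use \<beta> upper_angle_commute[OF met sub(3,2)] e in auto)
  have "\<forall>\<^sub>F t in at_right 0. t \<in> {0<..<r}" using pos by (intro eventually_at_right_real)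
  with 1 2 have "\<forall>\<^sub>F t in at_right (0::real). cos \<alpha> + cos \<beta> \<le> 0 + e"
  proof eventually_elim
    case (elim t)
    have M: "g x \<in> M" "n t \<in> M" "h y \<in> M"
      using geodesicD(2)[OF g] geodesicD(2)[OF h] geodesicD(2)[OF n] elim pos by auto
    have "x + y \<le> \<rho> (n t) (g x) + \<rho> (n t) (h y)"
      using m(4)[OF M] m(3)[OF M(1,2)] straight by simp
    then have "t * (cos \<alpha> + cos \<beta>) \<le> t * e" using elim by (simp add: algebra_simps)
    then show ?case using elim by simp
  qed
  then show "cos \<alpha> + cos \<beta> \<le> 0 + e" by simp
qed

text \<open>Equality would hold in the model plane, where the angles at the midpoint add up to pi
  and the two cosine laws cancel their angle terms. The length bound on the median is recorded
  because the final cosine estimate needs arguments in [0, pi].\<close>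

lemma median_comparison:
  assumes K: "K \<noteq> 0" and R: "Rk_domain K M \<rho>" and g: "geodesic M \<rho> (2 * l) g" and l: "0 < l"
    and B: "B \<in> M" "B \<noteq> g 0" "B \<noteq> g (2 * l)"
  shows "sgn K * (cs K (\<rho> (g 0) B) + cs K (\<rho> (g (2 * l)) B))
      \<le> sgn K * (2 * cs K l * cs K (\<rho> (g l) B))"
    and "K > 0 \<Longrightarrow> \<rho> (g l) B < pi / sqrt K"
proof -
  note met = Rk_domainD(1)[OF R]
  note m = metric_onD[OF met] and gd = geodesicD[OF g]
  have M: "g 0 \<in> M" "g l \<in> M" "g (2 * l) \<in> M" using gd(2) l by auto
  have r: "\<rho> (g l) (g 0) = l" "\<rho> (g l) (g (2 * l)) = l" "\<rho> (g 0) (g (2 * l)) = 2 * l"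
    using gd(3) l by auto
  have ne: "g 0 \<noteq> g l" "g (2 * l) \<noteq> g l" using r m(2)[OF M(2,2)] l by auto
  have "sgn K * (cs K (\<rho> (g 0) B) + cs K (\<rho> (g (2 * l)) B))
      \<le> sgn K * (2 * cs K l * cs K (\<rho> (g l) B))
    \<and> (K > 0 \<longrightarrow> \<rho> (g l) B < pi / sqrt K)"
  proof (cases "B = g l")
    case True
    have "\<rho> (g l) (g l) = 0" using m(2)[OF M(2,2)] by simp
    moreover have "cs K 0 = 1" by (simp add: cs_def)
    ultimately show ?thesis using True r m(3)[OF M(1,2)] m(3)[OF M(3,2)] by simp
  next
    case False
    define s where "s = \<rho> (g l) B"
    have s: "0 < s" using metric_on_pos[OF met M(2) B(1)] False by (auto simp: s_def)
    obtain S where "is_shortest M \<rho> (g l) B S" using Rk_domainD(2)[OF R M(2) B(1)] by blast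
    then obtain n where n: "geodesic M \<rho> s n" "n 0 = g l" "n s = B"
      using shortest_imp_geodesic[OF met] unfolding s_def by metis
    have g1: "geodesic M \<rho> l (\<lambda>t. g (l - t))"
      using geodesic_reverse[OF geodesic_restrict[OF g, of l]] l by simp
    have g2: "geodesic M \<rho> l (\<lambda>t. g (l + t))"
      using geodesic_shift[OF g, of l] l by simp
    have T1: "model_triangle K l s (\<rho> (g 0) B)"
      using Rk_domain_model_triangle[OF R M(2,1) B(1)] ne False B r by (auto simp: s_def)
    have T2: "model_triangle K l s (\<rho> (g (2 * l)) B)"
      using Rk_domain_model_triangle[OF R M(2,3) B(1)] ne False B r by (auto simp: s_def)
    obtain \<alpha> where \<alpha>: "upper_angle \<rho> (g l) ((\<lambda>t. g (l - t)) ` {0..l}) (n ` {0..s}) = ereal \<alpha>" "0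
        \<le> \<alpha>" "\<alpha> \<le> pi"
      using upper_angle_real[OF met g1 n(1) _ n(2)] l s by auto
    obtain \<beta> where \<beta>: "upper_angle \<rho> (g l) ((\<lambda>t. g (l + t)) ` {0..l}) (n ` {0..s}) = ereal \<beta>" "0
        \<le> \<beta>" "\<beta> \<le> pi"
      using upper_angle_real[OF met g2 n(1) _ n(2)] l s by auto
    have "cos \<alpha> + cos \<beta> \<le> 0"
      by (rule cos_adjacent_upper_angles[OF met g1 g2 n(1) _ _ n(2) l l s _ \<alpha> \<beta>])
        (use r in \<open>auto simp flip: mult_2\<close>)
    moreover have "\<alpha> \<le> model_angle K l s (\<rho> (g 0) B)"
      using upper_angle_le_model_angle[OF K R g1 n(1) _ n(2) l s] \<alpha> n B by simp
    moreover have "\<beta> \<le> model_angle K l s (\<rho> (g (2 * l)) B)"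
      using upper_angle_le_model_angle[OF K R g2 n(1) _ n(2) l s] \<beta> n B by (simp flip: mult_2)
    ultimately have "cos (model_angle K l s (\<rho> (g 0) B))
        + cos (model_angle K l s (\<rho> (g (2 * l)) B)) \<le> 0"
      using cos_monotone_0_pi_le[of \<alpha> "model_angle K l s (\<rho> (g 0) B)"] \<alpha> model_angle_bounds[OF K T1]
        cos_monotone_0_pi_le[of \<beta> "model_angle K l s (\<rho> (g (2 * l)) B)"] \<beta> model_angle_bounds[OF K
            T2]
      by linarith
    then have "sn K l * sn K s * (cos (model_angle K l s (\<rho> (g 0) B))
        + cos (model_angle K l s (\<rho> (g (2 * l)) B))) \<le> 0"
      using model_triangle_sn_pos[OF K T1] by (intro mult_nonneg_nonpos) auto
    then have "sgn K * (cs K (\<rho> (g 0) B) - cs K l * cs K s) + sgn K * (cs K (\<rho> (g (2 * l)) B)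
        - cs K l * cs K s) \<le> 0"
      unfolding distrib_left cos_model_angle[OF K T1] cos_model_angle[OF K T2] .
    then show ?thesis using model_triangle_less_pi(2)[OF T1] by (simp add: s_def algebra_simps)
  qed
  then show "sgn K * (cs K (\<rho> (g 0) B) + cs K (\<rho> (g (2 * l)) B))
      \<le> sgn K * (2 * cs K l * cs K (\<rho> (g l) B))"
    and "K > 0 \<Longrightarrow> \<rho> (g l) B < pi / sqrt K" by auto
qed

section \<open>From two medians to the quadrilateral\<close>

lemma cos_add_cos_le:
  fixes p q e :: real
  assumes "0 \<le> p" "p \<le> pi" "0 \<le> q" "q \<le> pi" "0 \<le> e" "e \<le> pi" "e \<le> p + q"
  shows "cos p + cos q \<le> 2 * cos (e / 2)"
proof -
  \<comment> \<open>Both factors are estimated separately: |p - q| \<le> pi makes the second one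
    nonnegative, and e \<le> pi allows replacing it by 1.\<close>
  have "cos p + cos q = 2 * (cos ((p + q) / 2) * cos ((p - q) / 2))" by (simp add: cos_plus_cos)
  moreover have "0 \<le> cos ((p - q) / 2)" using assms by (intro cos_ge_zero) auto
  then have "cos ((p + q) / 2) * cos ((p - q) / 2) \<le> cos (e / 2) * cos ((p - q) / 2)"
    using assms by (intro mult_right_mono cos_monotone_0_pi_le) auto
  moreover have "cos (e / 2) * cos ((p - q) / 2) \<le> cos (e / 2) * 1"
    using assms by (intro mult_left_mono cos_ge_zero) auto
  ultimately show ?thesis by simp
qed

lemma cosh_add_cosh_ge:
  fixes p q e :: real
  assumes "0 \<le> e" "e \<le> p + q"
  shows "2 * cosh (e / 2) \<le> cosh p + cosh q"
proof -
  have "cosh p + cosh q = 2 * (cosh ((p + q) / 2) * cosh ((p - q) / 2))"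
    using cosh_add[of "(p + q) / 2" "(p - q) / 2"] cosh_diff[of "(p + q) / 2" "(p - q) / 2"]
    by (simp add: field_simps)
  moreover have "cosh (e / 2) \<le> cosh ((p + q) / 2)"
    using assms by (simp add: cosh_real_nonneg_le_iff)
  moreover have "cosh ((p + q) / 2) * 1 \<le> cosh ((p + q) / 2) * cosh ((p - q) / 2)"
    by (intro mult_left_mono cosh_real_ge_1) auto
  ultimately show ?thesis by linarith
qed

theorem mainTheorem18:
  fixes K :: real and M :: "'a set" and \<rho> :: "'a \<Rightarrow> 'a \<Rightarrow> real" and A B C D :: 'a
  assumes "K \<noteq> 0"
    and "Rk_domain K M \<rho>"
    and "A \<in> M" "B \<in> M" "C \<in> M" "D \<in> M"
    and "A \<noteq> B" "A \<noteq> C" "A \<noteq> D" "B \<noteq> C" "B \<noteq> D" "C \<noteq> D"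
    and "K > 0 \<Longrightarrow> \<rho> A B + \<rho> B C + \<rho> C D + \<rho> D A < 2 * pi / sqrt K"
  shows "let \<kappa> = sqrt \<bar>K\<bar>; a = \<rho> A B; b = \<rho> B C; c = \<rho> C D; d = \<rho> A D;
             e = \<rho> B D; f = \<rho> A C in
         (K > 0 \<longrightarrow> cos (\<kappa> * a) + cos (\<kappa> * b) + cos (\<kappa> * c) + cos (\<kappa> * d)
                      \<le> 4 * cos (\<kappa> * e / 2) * cos (\<kappa> * f / 2)) \<and>
         (K < 0 \<longrightarrow> cosh (\<kappa> * a) + cosh (\<kappa> * b) + cosh (\<kappa> * c) + cosh (\<kappa> * d)
                      \<ge> 4 * cosh (\<kappa> * e / 2) * cosh (\<kappa> * f / 2))"
proof -
  note K = assms(1) and R = assms(2)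
  note met = Rk_domainD(1)[OF R]
  note m = metric_onD[OF met]
  define l where "l = \<rho> A C / 2"
  have f: "\<rho> A C = 2 * l" and l: "0 < l"
    using metric_on_pos[OF met assms(3,5,8)] by (auto simp: l_def)
  obtain S where "is_shortest M \<rho> A C S" using Rk_domainD(2)[OF R assms(3,5)] by blast
  then obtain g where g: "geodesic M \<rho> (2 * l) g" "g 0 = A" "g (2 * l) = C"
    using shortest_imp_geodesic[OF met] unfolding f[symmetric] by metis
  define p q where "p = \<rho> (g l) B" and "q = \<rho> (g l) D"
  have gl: "g l \<in> M" using geodesicD(2)[OF g(1)] l by simp
  have pq: "0 \<le> p" "0 \<le> q" "0 \<le> \<rho> B D" "\<rho> B D \<le> p + q"
    using m(1)[OF gl assms(4)] m(1)[OF gl assms(6)] m(1)[OF assms(4,6)] m(4)[OF assms(4) gl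
        assms(6)] m(3)[OF gl assms(4)]
    by (auto simp: p_def q_def)
  have 1: "sgn K * (cs K (\<rho> A B) + cs K (\<rho> B C)) \<le> sgn K * (2 * cs K l * cs K p)"
    and p: "K > 0 \<Longrightarrow> p < pi / sqrt K"
    using median_comparison[OF K R g(1) l assms(4)] g assms m(3)[OF assms(4,5)]
      by (auto simp: p_def)
  have 2: "sgn K * (cs K (\<rho> A D) + cs K (\<rho> C D)) \<le> sgn K * (2 * cs K l * cs K q)"
    and q: "K > 0 \<Longrightarrow> q < pi / sqrt K"
    using median_comparison[OF K R g(1) l assms(6)] g assms by (auto simp: q_def)
  define k where "k = sqrt \<bar>K\<bar>"
  have k: "0 < k" using K by (simp add: k_def)
  have kpq: "0 \<le> k * p" "0 \<le> k * q" "0 \<le> k * \<rho> B D" "k * \<rho> B D \<le> k * p + k * q"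
    using pq k by (auto simp flip: distrib_left)
  have pos: "cos (k * \<rho> A B) + cos (k * \<rho> B C) + cos (k * \<rho> C D) + cos (k * \<rho> A D)
      \<le> 4 * cos (k * \<rho> B D / 2) * cos (k * \<rho> A C / 2)" if "K > 0"
  proof -
    have kK: "k = sqrt K" using that by (simp add: k_def)
    have lt: "k * v \<le> pi" if "v < pi / sqrt K" for v
      using that k unfolding kK by (simp add: pos_less_divide_eq mult.commute)
    \<comment> \<open>A side of a triangle of perimeter below \<open>2 * pi / sqrt K\<close> is
      shorter than half of that; the triangles are \<open>A\<close>, \<open>B\<close>,
      \<open>C\<close> and \<open>A\<close>, \<open>B\<close>, \<open>D\<close>.\<close>
    have diam: "\<rho> A C < pi / sqrt K" "\<rho> B D < pi / sqrt K"
      using model_triangle_less_pi(1)[OF Rk_domain_model_triangle[OF R assms(3,5,4)] that]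
        model_triangle_less_pi(3)[OF Rk_domain_model_triangle[OF R assms(3,4,6)] that] assms by auto
    have kl: "- (pi / 2) \<le> k * l" using k l mult_pos_pos[of k l] pi_gt_zero by linarith
    have le: "k * \<rho> A C \<le> pi" "k * \<rho> B D \<le> pi" using lt diam by auto
    have "cos (k * p) + cos (k * q) \<le> 2 * cos (k * \<rho> B D / 2)"
      using kpq le lt[OF p[OF that]] lt[OF q[OF that]] by (intro cos_add_cos_le) auto
    \<comment> \<open>Multiplication preserves the inequality because k l is half of k times the
      diagonal \<open>\<rho> A C\<close>, hence at most pi / 2.\<close>
    then have "2 * cos (k * l) * (cos (k * p) + cos (k * q))
        \<le> 2 * cos (k * l) * (2 * cos (k * \<rho> B D / 2))"
      using le kl by (intro mult_left_mono mult_nonneg_nonneg cos_ge_zero) (auto simp: f)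
    then show ?thesis using 1 2 that by (simp add: cs_def k_def f algebra_simps)
  qed
  have neg: "4 * cosh (k * \<rho> B D / 2) * cosh (k * \<rho> A C / 2)
      \<le> cosh (k * \<rho> A B) + cosh (k * \<rho> B C) + cosh (k * \<rho> C D) + cosh (k * \<rho> A D)" if "K < 0"
  proof -
    have "2 * cosh (k * \<rho> B D / 2) \<le> cosh (k * p) + cosh (k * q)"
      using kpq by (intro cosh_add_cosh_ge)
    then have "2 * cosh (k * l) * (2 * cosh (k * \<rho> B D / 2))
        \<le> 2 * cosh (k * l) * (cosh (k * p) + cosh (k * q))"
      by (intro mult_left_mono) auto
    then show ?thesis using 1 2 that by (simp add: cs_def k_def f algebra_simps)
  qed
  show ?thesis using pos neg by (simp add: Let_def k_def)
qed

end
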